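(* Let $p$ be an odd prime, let $b,c\in\mathbb{Z}$ and put $d=b^2-4c$. (i) If $p\nmid d$, then $$\sum_{k=0}^{p-1}\frac{T_k(b,c)^2}{(-d)^k}\equiv\sum_{l=0}^{(p-1)/2}\binom{2l}{l}^2\left(-\frac{c}{4d}\right)^l\pmod{p^2}.$$ (ii) Let $m$ be an integer satisfying $(m-d)^2=16mc$. If $p\nmid md(m-d)$, then $$\sum_{k=0}^{p-1}\frac{T_k(b,c)^2}{m^k}\equiv\left(\frac{-1}{p}\right)+\frac{pd}{d-m}\left(\frac{-1}{p}\right)\left(q_p(d)-q_p(m)+S_{p-1}\left(\frac{m+d}{4m}\right)-S_{p-1}\left(\frac{m+d}{4d}\right)\right)\pmod{p^2}.$$
   Context: For $n\in\mathbb{N}$ and $b,c\in\mathbb{Z}$, $T_n(b,c)$ is the coefficient of $x^n$ in the expansion of $(x^2+bx+c)^n$; equivalently $T_n(b,c)=\sum_{k=0}^{\lfloor n/2\rfloor}\binom{n}{2k}\binom{2k}{k}b^{n-2k}c^k$. $\left(\frac{\cdot}{p}\right)$ is the Legendre symbol. For an integer $a$ with $p\nmid a$, $q_p(a)=(a^{p-1}-1)/p$ is the Fermat quotient. For a $p$-adic integer $x$, $S_{p-1}(x)=\sum_{k=1}^{p-1}\frac{\binom{2k}{k}}{k}x^k$. Congruences are between $p$-adic integers (rational numbers whose denominators are prime to $p$), modulo $p^2\mathbb{Z}_p$. *)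

theory Defs
  imports
    "HOL-Number_Theory.Number_Theory"
    "HOL-Computational_Algebra.Polynomial"
begin

definition trinomial_T :: "nat \<Rightarrow> int \<Rightarrow> int \<Rightarrow> int" where
  "trinomial_T n b c = coeff ([:c, b, 1:] ^ n) n"

text \<open>The rational numbers in $\mathbb{Z}_p$: reduced denominator prime to $p$.\<close>

definition p_integral :: "nat \<Rightarrow> rat \<Rightarrow> bool" where
  "p_integral p x \<longleftrightarrow> coprime (snd (quotient_of x)) (int p)"

text \<open>Congruence of rational $p$-adic integers modulo $p^e \mathbb{Z}_p$. Both sides are required
  to be $p$-integral.\<close>

definition padic_cong :: "nat \<Rightarrow> nat \<Rightarrow> rat \<Rightarrow> rat \<Rightarrow> bool" where
  "padic_cong p e x y \<longleftrightarrow>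
     p_integral p x \<and> p_integral p y \<and> (\<exists>z. p_integral p z \<and> x - y = of_nat p ^ e * z)"

definition fermat_quotient :: "nat \<Rightarrow> int \<Rightarrow> rat" where
  "fermat_quotient p a = (of_int a ^ (p - 1) - 1) / of_nat p"

text \<open>\<open>central_S n x\<close> is $S_n(x)$; only $n = p - 1$ and rational $x \in \mathbb{Z}_p$ are needed.\<close>

definition central_S :: "nat \<Rightarrow> rat \<Rightarrow> rat" where
  "central_S n x = (\<Sum>k=1..n. of_nat ((2 * k) choose k) / of_nat k * x ^ k)"

end

theory Submission
  imports Defs
begin

text \<open>
  Put \<open>y = c / d\<close>. Clausen's formula \<open>T\<^sub>k\<^sup>2 = \<Sum>\<^sub>j (k + j choose 2j)
    (2j choose j)\<^sup>2 c\<^sup>j d\<^bsup>k - j\<^esup>\<close> turns the sum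
  \<open>\<Sum>\<^sub>k T\<^sub>k\<^sup>2 / m\<^sup>k\<close> into \<open>\<Sum>\<^sub>j (2j choose j)\<^sup>2
    y\<^sup>j U\<^sub>j\<close> with \<open>U\<^sub>j = \<Sum>\<^sub>k (k + j choose 2j) t\<^sup>k\<close>
  and \<open>t = d / m\<close>; modulo \<open>p\<^sup>2\<close> only \<open>j \<le> h = (p - 1) / 2\<close>
    matters. The second difference in \<open>k\<close> of the
  binomial coefficient relates \<open>(1 - t)\<^sup>2 U\<^sub>j\<close> to \<open>t U\<^bsub>j -
    1\<^esub>\<close> up to two boundary terms divisible by \<open>p\<close>.
  For \<open>t = -1\<close> these cancel modulo \<open>p\<^sup>2\<close>, so \<open>U\<^sub>j\<close> is
    congruent to \<open>(-1/4)\<^sup>j\<close>, which is (i).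

  In (ii) the condition on \<open>m\<close> reads \<open>16 y = z\<close> with \<open>z = (1 - t)\<^sup>2 /
    t\<close>, and \<open>z\<^sup>j U\<^sub>j\<close> is congruent to
  \<open>U\<^sub>0 + p (1 + t) Q\<^sub>j(z)\<close>, where \<open>Q\<^sub>j\<close> has the coefficients
    \<open>(-1)\<^sup>i / (i (2i choose i))\<close>. The weights
  \<open>(2j choose j)\<^sup>2 / 16\<^sup>j\<close> are congruent to the coefficients of a Legendre polynomial
    of degree \<open>h\<close>, whose sum is
  \<open>(-1)\<^sup>h\<close>; so \<open>U\<^sub>0\<close> accounts for the main term and the Fermat quotients.
    The remaining weighted sum of the
  \<open>Q\<^sub>j\<close> satisfies a recurrence in \<open>h\<close> by Abel summation, which evaluates it as
  \<open>\<Sum>\<^sub>k (-1)\<^sup>k (t\<^bsup>-k\<^esup> - t\<^sup>k) / k\<close> up to simple factors. Modulo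
    \<open>p\<close> this is the difference of the two values of \<open>S\<close>.
\<close>

section \<open>The square of a trinomial coefficient\<close>

lemma trinomial_T_0 [simp]: "trinomial_T 0 b c = 1"
  by (simp add: trinomial_T_def)

lemma trinomial_T_1 [simp]: "trinomial_T (Suc 0) b c = b"
  by (simp add: trinomial_T_def)

lemma coeff_quadratic_mult:
  fixes r :: "int poly"
  shows "coeff ([:c, b, 1:] * r) (Suc (Suc j)) = c * coeff r (Suc (Suc j)) + b * coeff r (Suc j) + coeff r j"
  by simp

text \<open>With q = x^2 + bx + c, compare the coefficients of x^(j+1) on both sides of q * (q^n)' =
  n * q' * q^n.\<close>

lemma coeff_quadratic_power_deriv:
  fixes b c :: int
  defines "A \<equiv> \<lambda>n j. coeff ([:c, b, 1:] ^ n) j"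
  shows "c * (int j + 2) * A n (j + 2) + b * (int j + 1) * A n (j + 1) + int j * A n j
    = int n * (b * A n (j + 1) + 2 * A n j)"
proof (cases n)
  case 0
  then show ?thesis by (cases j) (auto simp: A_def)
next
  case (Suc m)
  let ?q = "[:c, b, 1:]"
  have "?q * pderiv (?q ^ n) = smult (int n) (pderiv ?q * ?q ^ n)"
    unfolding Suc pderiv_power_Suc by (simp add: algebra_simps del: mult_pCons_left mult_pCons_right)
  moreover have "pderiv ?q = [:b, 2:]" by (simp add: pderiv_pCons)
  ultimately have eq: "?q * pderiv (?q ^ n) = smult (int n) ([:b, 2:] * ?q ^ n)" by metis
  have "coeff (?q * pderiv (?q ^ n)) (Suc j) = coeff (smult (int n) ([:b, 2:] * ?q ^ n)) (Suc j)"
    unfolding eq ..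
  then show ?thesis
    by (cases j) (simp_all add: A_def coeff_pderiv algebra_simps)
qed

text \<open>The central coefficients of q^n, q^(n+1) and q^(n+2) are linear combinations of five
  coefficients of q^n around x^n. Three instances of the derivative relation eliminate the others.
  They reach down to index n - 2, so n = 0 and n = 1 are checked directly.\<close>

lemma trinomial_T_rec:
  "(int n + 2) * trinomial_T (n + 2) b c
   = (2 * int n + 3) * b * trinomial_T (n + 1) b c - (int n + 1) * (b\<^sup>2 - 4 * c) * trinomial_T n b c"
proof -
  consider "n = 0" | "n = 1" | m where "n = m + 2"
    by (metis One_nat_def add_2_eq_Suc' not0_implies_Suc)
  then show ?thesis
  proof cases
    case 1 then show ?thesis
      by (simp add: trinomial_T_def power2_eq_square algebra_simps numeral_2_eq_2)
  next
    case 2 then show ?thesis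
      by (simp add: trinomial_T_def power2_eq_square algebra_simps eval_nat_numeral)
  next
    case 3
    define A where "A = (\<lambda>n j. coeff ([:c, b, 1:] ^ n) j)"
    have D: "c * (int j + 2) * A n (j + 2) + b * (int j + 1) * A n (j + 1) + int j * A n j
        = int n * (b * A n (j + 1) + 2 * A n j)" for j
      using coeff_quadratic_power_deriv by (simp add: A_def)
    have step: "A (Suc k) (Suc (Suc j)) = c * A k (Suc (Suc j)) + b * A k (Suc j) + A k j" for k j
      unfolding A_def power_Suc coeff_quadratic_mult ..
    \<comment> \<open>Here n = m + 2, so \<open>a2\<close> is the coefficient of x^n, the central
      one.\<close>
    define a0 a1 a2 a3 a4 where "a0 = A n m" "a1 = A n (Suc m)"
      "a2 = A n (Suc (Suc m))" "a3 = A n (Suc (Suc (Suc m)))" "a4 = A n (Suc (Suc (Suc (Suc m))))"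
    note a_def = this
    have d0: "c * (int m + 2) * a2 + b * (int m + 1) * a1 + int m * a0 = (int m + 2) * (b * a1 + 2 * a0)"
      using D[of m] 3 by (simp add: a_def add_ac)
    have d1: "c * (int m + 3) * a3 + b * (int m + 2) * a2 + (int m + 1) * a1 = (int m + 2) * (b * a2 + 2 * a1)"
      using D[of "m+1"] 3 by (simp add: a_def add_ac)
    have d2: "c * (int m + 4) * a4 + b * (int m + 3) * a3 + (int m + 2) * a2 = (int m + 2) * (b * a3 + 2 * a2)"
      using D[of "m+2"] 3 by (simp add: a_def add_ac)
    \<comment> \<open>In the relation centred at x^n the \<open>a2\<close> terms cancel, which
      leaves the symmetry of q^n under x -> c / x.\<close>
    have "(int m + 3) * (c * a3 - a1) = 0" using d1 by (simp add: algebra_simps)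
    then have sym: "c * a3 = a1" by simp
    have T0: "trinomial_T n b c = a2" by (simp add: trinomial_T_def A_def a_def 3)
    have T1: "trinomial_T (n+1) b c = c * a3 + b * a2 + a1"
      using step[of n "m+1"] 3 by (simp add: trinomial_T_def A_def a_def eval_nat_numeral)
    have T2: "trinomial_T (n+2) b c = c * (c * a4 + b * a3 + a2) + b * (c * a3 + b * a2 + a1) + (c * a2 + b *
      a1 + a0)"
      using step[of "Suc n" "m+2"] step[of n "m+2"] step[of n "m+1"] step[of n m] 3 
      by (simp add: trinomial_T_def A_def a_def eval_nat_numeral del: power_Suc)
    have "int n = int m + 2" using 3 by simp
    then show ?thesis unfolding T0 T1 T2
      using d0 d2 sym by Groebner_Basis.algebra
  qed
qed

section \<open>Binomial ratios and the coefficients in Clausen's formula\<close>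

lemma choose_Suc_eq: "of_nat (n choose Suc k) * (of_nat k + 1 :: rat) = of_nat (n choose k) * (of_nat n - of_nat k)"
proof (cases "k \<le> n")
  case True
  have "Suc k * (n choose Suc k) = (n - k) * (n choose k)"
    by (metis binomial_absorb_comp binomial_absorption)
  then have "of_nat (Suc k * (n choose Suc k)) = (of_nat ((n - k) * (n choose k)) :: rat)" by simp
  then show ?thesis using True by (simp add: of_nat_diff algebra_simps)
qed (simp add: binomial_eq_0)

lemma Suc_choose_eq: "(of_nat n + 1 - of_nat k) * of_nat (Suc n choose k) = (of_nat n + 1 :: rat) * of_nat (n
  choose k)"
proof (cases k)
  case (Suc j)
  have "Suc j * (Suc n choose Suc j) = Suc n * (n choose j)" by (rule Suc_times_binomial)
  from arg_cong[OF this, of "of_nat :: nat \<Rightarrow> rat"] choose_Suc_eq[of n j]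
  show ?thesis unfolding Suc binomial_Suc_Suc of_nat_add of_nat_mult of_nat_Suc by Groebner_Basis.algebra
qed simp

lemma central_binomial_Suc:
  "(of_nat k + 1) * of_nat ((2 * k + 2) choose (k + 1)) = (2 * (2 * of_nat k + 1) :: rat) * of_nat ((2 * k) choose k)"
proof -
  have "(2 * k + 2) choose (k + 1) = 2 * ((2 * k + 1) choose k)"
  proof -
    have "(2 * k + 1) choose Suc k = (2 * k + 1) choose k"
      by (subst binomial_symmetric) auto
    then show ?thesis by (simp add: numeral_2_eq_2)
  qed
  moreover have "(2 * of_nat k + 1 - of_nat k) * of_nat (Suc (2 * k) choose k) = (2 * of_nat k + 1 :: rat) *
    of_nat ((2 * k) choose k)"
    using Suc_choose_eq[of "2 * k" k] by simp
  ultimately show ?thesis by (simp add: algebra_simps)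
qed

lemma choose_add_even_Suc_lower:
  "of_nat ((n + Suc k) choose (2 * Suc k)) * (2 * (of_nat k + 1) * (2 * of_nat k + 1)) =
   (of_nat ((n + k) choose (2 * k)) * ((of_nat n - of_nat k) * (of_nat n + of_nat k + 1)) :: rat)"
proof -
  have "of_nat ((n + Suc k) choose (2 * Suc k)) * (2 * of_nat k + 2 :: rat) = (of_nat n + of_nat k + 1) *
    of_nat ((n + k) choose (2 * k + 1))"
    using arg_cong[OF Suc_times_binomial[of "2 * k + 1" "n + k"], of "of_nat :: nat \<Rightarrow> rat"]
    by (simp add: algebra_simps)
  moreover have "of_nat ((n + k) choose (2 * k + 1)) * (2 * of_nat k + 1) = (of_nat ((n + k) choose (2 * k)) *
    (of_nat n - of_nat k) :: rat)"
    using choose_Suc_eq[of "n + k" "2 * k"] by simp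
  ultimately show ?thesis by Groebner_Basis.algebra
qed

lemma choose_add_even_Suc_upper:
  "(of_nat n + 1 - of_nat k) * of_nat ((Suc n + k) choose (2 * k)) = (of_nat n + of_nat k + 1 :: rat) * of_nat
    ((n + k) choose (2 * k))"
  using Suc_choose_eq[of "n + k" "2 * k"] by (simp add: algebra_simps)

text \<open>These are the coefficients in y of the terminating hypergeometric series 3F2(-n, n + 1,
  1/2; 1, 1; -4y), which Clausen's formula equates with the square of a Legendre polynomial.\<close>

definition clausen_coeff :: "nat \<Rightarrow> nat \<Rightarrow> rat" where
  "clausen_coeff n k = of_nat ((n + k) choose (2 * k)) * of_nat ((2 * k) choose k) ^ 2"

text \<open>The coefficients of \<open>n b T\<^sub>n T\<^bsub>n-1\<^esub> / d\<^sup>n\<close> in powers of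
  \<open>c / d\<close>, found from the two linear
  relations between this product and the squares.\<close>

definition mixed_coeff :: "nat \<Rightarrow> nat \<Rightarrow> rat" where
  "mixed_coeff n k = clausen_coeff n k * (of_nat k ^ 2 + 2 * of_nat n ^ 2 * of_nat k - of_nat n ^ 2)
     / ((of_nat n + of_nat k) * (2 * of_nat k - 1))"

lemma clausen_coeff_0 [simp]: "clausen_coeff n 0 = 1"
  by (simp add: clausen_coeff_def)

lemma clausen_coeff_eq_0: "n < k \<Longrightarrow> clausen_coeff n k = 0"
  by (simp add: clausen_coeff_def)

lemma clausen_coeff_Suc_lower:
  "clausen_coeff n (Suc k) = clausen_coeff n k
     * ((of_nat n - of_nat k) * (of_nat n + of_nat k + 1) * 2 * (2 * of_nat k + 1)) / (of_nat k + 1) ^ 3"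
proof -
  define K where "K = (of_nat k :: rat)"
  have K: "K + 1 > 0" "2 * K + 1 > 0" unfolding K_def by (simp_all add: add_nonneg_pos)
  have 1: "of_nat ((n + Suc k) choose (2 * Suc k)) = 
     of_nat ((n + k) choose (2 * k)) * ((of_nat n - K) * (of_nat n + K + 1)) / (2 * (K + 1) * (2 * K + 1))"
    using choose_add_even_Suc_lower[of n k] K unfolding K_def by (subst nonzero_eq_divide_eq) auto
  have 2: "of_nat ((2 * Suc k) choose (Suc k)) = 2 * (2 * K + 1) * of_nat ((2 * k) choose k) / (K + 1)"
    using central_binomial_Suc[of k] K by (simp add: K_def field_simps)
  have "(a * X / (2 * (K + 1) * (2 * K + 1))) * (2 * (2 * K + 1) * b / (K + 1)) ^ 2
     = (a * b ^ 2) * (X * 2 * (2 * K + 1)) / (K + 1) ^ 3" for a b X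
    using K by (simp add: divide_simps) Groebner_Basis.algebra
  then show ?thesis
    unfolding clausen_coeff_def 1 2 K_def[symmetric] by simp
qed

text \<open>The factor n + 1 - k of the ratio in k cancels the one of the ratio in n. No division by
  it occurs, so k = n + 1 is covered. This rule and the next refer neighbouring coefficients to one
  base coefficient, which turns the later identities into identities of rational functions in n and
  k.\<close>

lemma clausen_coeff_Suc_Suc:
  "clausen_coeff (Suc n) (Suc k) = clausen_coeff n k
     * ((of_nat n + of_nat k + 1) * (of_nat n + of_nat k + 2) * 2 * (2 * of_nat k + 1)) / (of_nat k + 1) ^ 3"
proof -
  have "(of_nat n + 1 - of_nat k) * clausen_coeff (Suc n) k = (of_nat n + of_nat k + 1) * clausen_coeff n k"
    using choose_add_even_Suc_upper[of n k] unfolding clausen_coeff_def by Groebner_Basis.algebra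
  then have "clausen_coeff (Suc n) k * ((of_nat n + 1 - of_nat k) * (of_nat n + 1 + of_nat k + 1) * 2 * (2 *
    of_nat k + 1))
    = clausen_coeff n k * ((of_nat n + of_nat k + 1) * (of_nat n + of_nat k + 2) * 2 * (2 * of_nat k + 1))"
    by Groebner_Basis.algebra
  then show ?thesis
    unfolding clausen_coeff_Suc_lower[of "Suc n"] of_nat_Suc by (simp only: add_ac)
qed

lemma clausen_coeff_pred_Suc:
  "clausen_coeff n (Suc k) = clausen_coeff (Suc n) k
     * ((of_nat n - of_nat k) * (of_nat n + 1 - of_nat k) * 2 * (2 * of_nat k + 1)) / (of_nat k + 1) ^ 3"
proof -
  have "(of_nat n + 1 - of_nat k) * clausen_coeff (Suc n) k = (of_nat n + of_nat k + 1) * clausen_coeff n k"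
    using choose_add_even_Suc_upper[of n k] unfolding clausen_coeff_def by Groebner_Basis.algebra
  then have "clausen_coeff n k * ((of_nat n - of_nat k) * (of_nat n + of_nat k + 1) * 2 * (2 * of_nat k + 1))
    = clausen_coeff (Suc n) k * ((of_nat n - of_nat k) * (of_nat n + 1 - of_nat k) * 2 * (2 * of_nat k + 1))"
    by Groebner_Basis.algebra
  then show ?thesis
    unfolding clausen_coeff_Suc_lower[of n] by simp
qed

lemma mixed_coeff_0: "mixed_coeff (Suc n) 0 = of_nat (Suc n)"
  by (simp add: mixed_coeff_def power2_eq_square del: of_nat_Suc)

lemma mixed_coeff_Suc:
  assumes "n > 0"
  shows "mixed_coeff n (Suc k) = clausen_coeff n k
     * ((of_nat n - of_nat k) * 2 * ((of_nat k + 1) ^ 2 + 2 * of_nat n ^ 2 * (of_nat k + 1) - of_nat n ^ 2)) /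
       (of_nat k + 1) ^ 3"
proof -
  have "(of_nat n + of_nat k + 1 :: rat) > 0" "(2 * of_nat k + 1 :: rat) > 0"
    by (simp_all add: add_nonneg_pos)
  then show ?thesis unfolding mixed_coeff_def clausen_coeff_Suc_lower
    by (simp add: divide_simps) (intro disjI2, Groebner_Basis.algebra)
qed

lemma mixed_coeff_Suc_Suc:
  shows "mixed_coeff (Suc n) (Suc k) = clausen_coeff n k
     * ((of_nat n + of_nat k + 1) * 2 * ((of_nat k + 1) ^ 2 + 2 * (of_nat n + 1) ^ 2 * (of_nat k + 1) - (of_nat
       n + 1) ^ 2)) / (of_nat k + 1) ^ 3"
proof -
  have "(of_nat n + of_nat k + 2 :: rat) > 0" "(2 * of_nat k + 1 :: rat) > 0"
    by (simp_all add: add_nonneg_pos)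
  then show ?thesis unfolding mixed_coeff_def clausen_coeff_Suc_Suc
    by (simp add: divide_simps) (intro disjI2, Groebner_Basis.algebra)
qed

text \<open>Write Z_n = n b T_n T_(n-1) / d^n. The recurrence times b T_n, with b^2 / d = 1 + 4y,
  gives Z_(n+1) + Z_n = (2n + 1)(1 + 4y) T_n^2 / d^n; this is its coefficient of y^(k+1).\<close>

lemma mixed_coeff_sum:
  assumes "n > 0"
  shows "mixed_coeff (Suc n) (Suc k) + mixed_coeff n (Suc k)
     = (2 * of_nat n + 1) * (clausen_coeff n (Suc k) + 4 * clausen_coeff n k)"
proof -
  have "(of_nat k + 1 :: rat) > 0" by (simp add: add_nonneg_pos)
  then show ?thesis
    unfolding mixed_coeff_Suc_Suc mixed_coeff_Suc[OF assms] clausen_coeff_Suc_lower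
    by (simp add: divide_simps) Groebner_Basis.algebra
qed

text \<open>Coefficient form of the second relation, in which the squares with indices n + 2 and n
  determine Z_(n+2) - Z_(n+1).\<close>

lemma mixed_coeff_diff:
  "(of_nat n + 2) ^ 2 * clausen_coeff (Suc (Suc n)) k - (of_nat n + 1) ^ 2 * clausen_coeff n k
     = (2 * of_nat n + 3) * (mixed_coeff (Suc (Suc n)) k - mixed_coeff (Suc n) k)"
proof (cases k)
  case 0
  show ?thesis unfolding 0 by (simp add: mixed_coeff_0 power2_eq_square algebra_simps)
next
  case (Suc j)
  have "(of_nat j + 1 :: rat) > 0" by (simp add: add_nonneg_pos)
  then show ?thesis
    unfolding Suc mixed_coeff_Suc_Suc[of "Suc n"] mixed_coeff_Suc[of "Suc n", OF zero_less_Suc]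
      clausen_coeff_Suc_Suc[of "Suc n"]
      clausen_coeff_pred_Suc[of n] of_nat_Suc
    by (simp add: divide_simps) Groebner_Basis.algebra
qed

text \<open>Clausen's formula for the square of a Legendre polynomial. Together with the companion expansion of
  \<open>T\<^sub>n T\<^bsub>n-1\<^esub>\<close> it is closed under the three-term recurrence.\<close>

lemma trinomial_T_square_mixed:
  fixes b c d :: int
  assumes d: "d = b ^ 2 - 4 * c" "d \<noteq> 0"
  defines "y \<equiv> of_int c / of_int d :: rat"
  assumes "Suc n \<le> N"
  shows "of_int (trinomial_T n b c) ^ 2 / of_int d ^ n = (\<Sum>k\<le>N. clausen_coeff n k * y ^ k)
    \<and> of_int (trinomial_T (Suc n) b c) ^ 2 / of_int d ^ Suc n = (\<Sum>k\<le>N. clausen_coeff (Suc n) k * y ^ k)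
    \<and> of_nat (Suc n) * of_int (b * trinomial_T (Suc n) b c * trinomial_T n b c) / of_int d ^ Suc n
      = (\<Sum>k\<le>N. mixed_coeff (Suc n) k * y ^ k)"
  using \<open>Suc n \<le> N\<close>
proof (induction n)
  case 0
  obtain M where M: "N = Suc M" using assms(4) by (cases N) auto
  have dr: "of_int b ^ 2 = (of_int d + 4 * of_int c :: rat)" using d(1) by simp
  have b2: "of_int b ^ 2 / of_int d = 1 + 4 * y"
    using d(2) dr by (simp add: y_def field_simps)
  have tail0: "(\<Sum>k\<le>M. clausen_coeff 0 (Suc k) * z k) = 0" for z
    by (intro sum.neutral) (auto simp: clausen_coeff_eq_0)
  have tail1: "(\<Sum>k<M. clausen_coeff (Suc 0) (Suc (Suc k)) * z k) = 0" for z
    by (intro sum.neutral) (auto simp: clausen_coeff_eq_0)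
  have tail2: "(\<Sum>k<M. mixed_coeff (Suc 0) (Suc (Suc k)) * z k) = 0" for z
    by (intro sum.neutral) (auto simp: clausen_coeff_eq_0 mixed_coeff_def)
  have v: "clausen_coeff (Suc 0) (Suc 0) = 4" "mixed_coeff (Suc 0) 0 = 1" "mixed_coeff (Suc 0) (Suc 0) = 4"
    by (simp_all add: clausen_coeff_def mixed_coeff_def numeral_2_eq_2)
  have split1: "sum g {..Suc M} = g 0 + (\<Sum>k\<le>M. g (Suc k))" for g :: "nat \<Rightarrow> rat"
    by (rule sum.atMost_Suc_shift)
  have split2: "sum g {..M} = g 0 + (\<Sum>k<M. g (Suc k))" for g :: "nat \<Rightarrow> rat"
    by (rule sum.atMost_shift)
  have "(\<Sum>k\<le>N. clausen_coeff 0 k * y ^ k) = 1"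
    unfolding M split1 tail0 by simp
  moreover have "(\<Sum>k\<le>N. clausen_coeff (Suc 0) k * y ^ k) = 1 + 4 * y"
    unfolding M split1 split2 tail1 using v by simp
  moreover have "(\<Sum>k\<le>N. mixed_coeff (Suc 0) k * y ^ k) = 1 + 4 * y"
    unfolding M split1 split2 tail2 using v by simp
  ultimately show ?case using b2 by (simp add: power2_eq_square)
next
  case (Suc n)
  \<comment> \<open>\<open>\<tau>\<close> is the normalised square. \<open>\<zeta>\<close> at n is
    the normalised mixed product with indices n + 1 and n, so its coefficients carry the index
    \<open>Suc n\<close>.\<close>
  define \<tau> where "\<tau> = (\<lambda>n. of_int (trinomial_T n b c) ^ 2 / of_int d ^ n :: rat)"
  define \<zeta> where "\<zeta> = (\<lambda>n. of_nat (Suc n) * of_int (b * trinomial_T (Suc n) b c *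
    trinomial_T n b c) / of_int d ^ Suc n :: rat)"
  define D B where "D = (of_int d :: rat)" and "B = (of_int b :: rat)"
  define A where "A = (\<lambda>n. of_int (trinomial_T n b c) :: rat)"
  have D0: "D \<noteq> 0" using d(2) by (simp add: D_def)
  have "of_int ((int n + 2) * trinomial_T (n + 2) b c) = (of_int 
    ((2 * int n + 3) * b * trinomial_T (n + 1) b c - (int n + 1) * d * trinomial_T n b c) :: rat)"
    unfolding trinomial_T_rec d ..
  then have rec: "(of_nat n + 2) * A (Suc (Suc n)) = (2 * of_nat n + 3) * B * A (Suc n) - (of_nat n + 1) * D * A n"
    by (simp add: A_def B_def D_def)
  have dr: "of_int b ^ 2 = (of_int d + 4 * of_int c :: rat)" using d(1) by simp
  have b2: "B ^ 2 = (1 + 4 * y) * D"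
    using d(2) dr by (simp add: y_def B_def D_def field_simps)
  have \<tau>: "\<tau> n = A n ^ 2 / D ^ n" and \<zeta>: "\<zeta> n = (of_nat n + 1) * (B * A (Suc n) * A n) /
    D ^ Suc n" for n
    by (simp_all add: \<tau>_def \<zeta>_def A_def B_def D_def add.commute)
  define P where "P = D ^ n"
  have P0: "P \<noteq> 0" using D0 by (simp add: P_def)
  have n1: "of_nat (Suc n) + 1 = (of_nat n + 2 :: rat)" by simp
  have zt: "\<zeta> (Suc n) + \<zeta> n = (2 * of_nat n + 3) * (1 + 4 * y) * \<tau> (Suc n)"
  proof -
    have "(of_nat n + 2) * (B * A (Suc (Suc n)) * A (Suc n)) + (of_nat n + 1) * (B * A (Suc n) * A n) * D
      = (2 * of_nat n + 3) * (1 + 4 * y) * A (Suc n) ^ 2 * D"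
    proof -
      have "(of_nat n + 2) * (B * A (Suc (Suc n)) * A (Suc n)) + (of_nat n + 1) * (B * A (Suc n) * A n) * D
        = B * A (Suc n) * ((of_nat n + 2) * A (Suc (Suc n)) + (of_nat n + 1) * D * A n)"
        by (simp add: algebra_simps)
      also have "\<dots> = (2 * of_nat n + 3) * B ^ 2 * A (Suc n) ^ 2"
        unfolding rec by (simp add: power2_eq_square)
      finally show ?thesis unfolding b2 by (simp only: mult_ac)
    qed
    moreover have "k2 * X / (D * (D * P)) + k1 * Y / (D * P) = r * u * (W / (D * P))"
      if "k2 * X + k1 * Y * D = r * u * W * D" for k2 k1 X Y r u W
      using that D0 P0 by (simp add: divide_simps)
    ultimately show ?thesis
      unfolding \<zeta> \<tau> power_Suc n1 P_def by presburger
  qed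
  have tz: "(of_nat n + 2) ^ 2 * \<tau> (Suc (Suc n)) - (of_nat n + 1) ^ 2 * \<tau> n = (2 * of_nat n + 3) *
    (\<zeta> (Suc n) - \<zeta> n)"
  proof -
    have "(of_nat n + 2) ^ 2 * A (Suc (Suc n)) ^ 2 - (of_nat n + 1) ^ 2 * A n ^ 2 * D ^ 2
      = (2 * of_nat n + 3) * ((of_nat n + 2) * (B * A (Suc (Suc n)) * A (Suc n)) - (of_nat n + 1) * (B * A (Suc
        n) * A n) * D)"
    proof -
      \<comment> \<open>The recurrence says U + V = R for the outer terms U, V and the middle term
        R, so R factors out of the difference of squares.\<close>
      have "U ^ 2 - V ^ 2 = R * (U - V)" if "U = R - V" for U V R :: rat
        using that by Groebner_Basis.algebra
      from this[OF rec] show ?thesis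
        by (simp add: power_mult_distrib right_diff_distrib mult_ac)
    qed
    moreover have "k2 * (X / (D * (D * P))) - k1 * (Y / P) = r * (l2 * Z / (D * (D * P)) - l1 * W / (D * P))"
      if "k2 * X - k1 * Y * D ^ 2 = r * (l2 * Z - l1 * W * D)" for k2 k1 X Y r l2 l1 Z W
      using that D0 P0 by (simp add: divide_simps) Groebner_Basis.algebra
    ultimately show ?thesis
      unfolding \<zeta> \<tau> power_Suc n1 P_def by presburger
  qed
  have N: "Suc n < N" and IH: "\<tau> n = (\<Sum>k\<le>N. clausen_coeff n k * y ^ k)"
    "\<tau> (Suc n) = (\<Sum>k\<le>N. clausen_coeff (Suc n) k * y ^ k)" "\<zeta> n = (\<Sum>k\<le>N.
      mixed_coeff (Suc n) k * y ^ k)"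
    using Suc unfolding \<tau>_def \<zeta>_def by simp_all
  obtain M where M: "N = Suc M" using N by (cases N) auto
  \<comment> \<open>Multiplication by 4y shifts the exponents. The top coefficient vanishes since
    \<open>Suc n < N\<close>, so the shifted copy still fits below N.\<close>
  have shift: "(1 + 4 * y) * (\<Sum>k\<le>N. clausen_coeff (Suc n) k * y ^ k) =
     1 + (\<Sum>k\<le>M. (clausen_coeff (Suc n) (Suc k) + 4 * clausen_coeff (Suc n) k) * y ^ Suc k)"
  proof -
    have "(\<Sum>k\<le>N. clausen_coeff (Suc n) k * y ^ k) = (\<Sum>k\<le>M. clausen_coeff (Suc n) k * y ^ k)"
      using N unfolding M by (simp add: clausen_coeff_eq_0)
    moreover have "(\<Sum>k\<le>N. clausen_coeff (Suc n) k * y ^ k) = 1 + (\<Sum>k\<le>M. clausen_coeff (Suc n)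
      (Suc k) * y ^ Suc k)"
      unfolding M sum.atMost_Suc_shift by simp
    moreover have "(1 + 4 * y) * z = z + 4 * y * z" for z by (simp add: distrib_right)
    ultimately have "(1 + 4 * y) * (\<Sum>k\<le>N. clausen_coeff (Suc n) k * y ^ k)
      = (1 + (\<Sum>k\<le>M. clausen_coeff (Suc n) (Suc k) * y ^ Suc k)) + 4 * y * (\<Sum>k\<le>M.
        clausen_coeff (Suc n) k * y ^ k)"
      by presburger
    then show ?thesis
      by (simp add: algebra_simps sum.distrib sum_distrib_left)
  qed
  have \<zeta>s: "\<zeta> (Suc n) = (\<Sum>k\<le>N. mixed_coeff (Suc (Suc n)) k * y ^ k)"
  proof -
    have "\<zeta> (Suc n) = (2 * of_nat n + 3) * ((1 + 4 * y) * \<tau> (Suc n)) - \<zeta> n"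
      using zt by (simp add: mult.assoc)
    also have "\<dots> = (2 * of_nat n + 3) * (1 + (\<Sum>k\<le>M. (clausen_coeff (Suc n) (Suc k) + 4 *
      clausen_coeff (Suc n) k) * y ^ Suc k))
         - (\<Sum>k\<le>N. mixed_coeff (Suc n) k * y ^ k)"
      unfolding IH shift ..
    also have "\<dots> = mixed_coeff (Suc (Suc n)) 0 + (\<Sum>k\<le>M. ((2 * of_nat n + 3) * (clausen_coeff
      (Suc n) (Suc k) + 4 * clausen_coeff (Suc n) k)
         - mixed_coeff (Suc n) (Suc k)) * y ^ Suc k)"
      unfolding M sum.atMost_Suc_shift mixed_coeff_0
      by (simp add: algebra_simps sum.distrib sum_distrib_left sum_subtractf)
    also have "\<dots> = mixed_coeff (Suc (Suc n)) 0 + (\<Sum>k\<le>M. mixed_coeff (Suc (Suc n)) (Suc k) * y ^ Suc k)"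
    proof -
      have "(2 * of_nat n + 3) * (clausen_coeff (Suc n) (Suc k) + 4 * clausen_coeff (Suc n) k) - mixed_coeff
        (Suc n) (Suc k)
         = mixed_coeff (Suc (Suc n)) (Suc k)" for k
        using mixed_coeff_sum[of "Suc n" k] by (simp add: algebra_simps)
      then show ?thesis by simp
    qed
    finally show ?thesis unfolding M sum.atMost_Suc_shift by simp
  qed
  have n2: "(of_nat n + 2 :: rat) ^ 2 \<noteq> 0" by (simp add: add_nonneg_eq_0_iff)
  have \<tau>s: "\<tau> (Suc (Suc n)) = (\<Sum>k\<le>N. clausen_coeff (Suc (Suc n)) k * y ^ k)"
  proof -
    have "(of_nat n + 2) ^ 2 * \<tau> (Suc (Suc n)) = (of_nat n + 1) ^ 2 * \<tau> n + (2 * of_nat n + 3) *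
      (\<zeta> (Suc n) - \<zeta> n)"
      using tz by simp
    also have "\<dots> = (\<Sum>k\<le>N. ((of_nat n + 1) ^ 2 * clausen_coeff n k + (2 * of_nat n + 3) *
      (mixed_coeff (Suc (Suc n)) k - mixed_coeff (Suc n) k)) * y ^ k)"
      unfolding IH \<zeta>s by (simp add: algebra_simps sum.distrib sum_distrib_left sum_subtractf)
    also have "\<dots> = (\<Sum>k\<le>N. ((of_nat n + 2) ^ 2 * clausen_coeff (Suc (Suc n)) k) * y ^ k)"
      unfolding mixed_coeff_diff[symmetric] by simp
    also have "\<dots> = (of_nat n + 2) ^ 2 * (\<Sum>k\<le>N. clausen_coeff (Suc (Suc n)) k * y ^ k)"
      by (simp add: sum_distrib_left mult.assoc)
    finally show ?thesis using n2 mult_left_cancel by blast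
  qed
  show ?case using IH(2) \<tau>s \<zeta>s unfolding \<tau>_def \<zeta>_def by (intro conjI)
qed

lemma trinomial_T_square:
  fixes b c d :: int
  assumes "d = b ^ 2 - 4 * c" "d \<noteq> 0" "n \<le> N"
  shows "of_int (trinomial_T n b c) ^ 2 = of_int d ^ n * (\<Sum>k\<le>N. clausen_coeff n k * (of_int c / of_int
    d) ^ k)"
proof -
  have "of_int (trinomial_T n b c) ^ 2 / of_int d ^ n = (\<Sum>k\<le>N. clausen_coeff n k * (of_int c / of_int
    d) ^ k)"
  proof (cases n)
    case 0
    have "(\<Sum>k\<le>N. clausen_coeff 0 k * z k) = z 0" for z
      by (subst sum.remove[of _ 0]) (auto intro!: sum.neutral simp: clausen_coeff_eq_0)
    then show ?thesis using 0 by simp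
  next
    case (Suc m)
    then show ?thesis using trinomial_T_square_mixed[of d b c m N] assms by simp
  qed
  then show ?thesis using assms(2) by (simp add: field_simps)
qed

section \<open>Truncations of the power series of t^j / (1 - t)^(2j + 1)\<close>

definition shifted_gf :: "nat \<Rightarrow> nat \<Rightarrow> rat \<Rightarrow> rat" where
  "shifted_gf n j t = (\<Sum>k<n. of_nat ((k + j) choose (2 * j)) * t ^ k)"

text \<open>The second difference of \<open>k + j + 1\<close> over \<open>2j + 2\<close> in \<open>k\<close> is
  \<open>k + j\<close> over \<open>2j\<close>.\<close>

lemma shifted_gf_Suc:
  "(1 - t) ^ 2 * shifted_gf n (Suc j) t = t * shifted_gf n j t
     - of_nat ((n + Suc j) choose (2 * Suc j)) * t ^ n + of_nat ((n + j) choose (2 * Suc j)) * t ^ Suc n"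
proof (induction n)
  case 0
  show ?case by (simp add: shifted_gf_def binomial_eq_0 del: binomial_Suc_Suc)
next
  case (Suc n)
  \<comment> \<open>By Pascal's rule these entries of row n + j express every binomial of the step:
    the values at 2j + 2 run through c, b + c, a + 2b + c, with second difference a.\<close>
  define a b c where "a = (of_nat ((n + j) choose (2 * j)) :: rat)" and "b = (of_nat ((n + j) choose (2 * j +
    1)) :: rat)"
    and "c = (of_nat ((n + j) choose (2 * j + 2)) :: rat)"
  have 1: "of_nat ((n + Suc j) choose (2 * Suc j)) = b + c" "of_nat ((n + j) choose (2 * Suc j)) = c"
    "of_nat ((Suc n + Suc j) choose (2 * Suc j)) = a + 2 * b + c" "of_nat ((Suc n + j) choose (2 * Suc j)) = b + c"
    by (simp_all add: a_def b_def c_def)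
  have 2: "shifted_gf (Suc n) (Suc j) t = shifted_gf n (Suc j) t + (b + c) * t ^ n"
    "shifted_gf (Suc n) j t = shifted_gf n j t + a * t ^ n"
    unfolding 1(1)[symmetric] by (simp_all add: shifted_gf_def a_def)
  have "(1 - t) ^ 2 * (u + (b + c) * s) = t * (v + a * s) - (a + 2 * b + c) * (t * s) + (b + c) * (t * (t * s))"
    if "(1 - t) ^ 2 * u = t * v - (b + c) * s + c * (t * s)" for u v s
    using that by Groebner_Basis.algebra
  from this[OF Suc.IH[unfolded 1 power_Suc]] show ?case
    unfolding 1 2 power_Suc .
qed

text \<open>Clausen's expansion may use the same bound n on j for every k, so the two finite sums
  can be interchanged.\<close>

lemma sum_trinomial_T_square:
  fixes b c d :: int and \<mu> :: rat
  assumes d: "d = b ^ 2 - 4 * c" "d \<noteq> 0"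
  shows "(\<Sum>k=0..n. of_int (trinomial_T k b c) ^ 2 / \<mu> ^ k)
    = (\<Sum>j\<le>n. of_nat ((2 * j) choose j) ^ 2 * (of_int c / of_int d) ^ j * shifted_gf (Suc n) j (of_int
      d / \<mu>))"
proof -
  let ?y = "of_int c / of_int d :: rat"
  have "(\<Sum>k=0..n. of_int (trinomial_T k b c) ^ 2 / \<mu> ^ k)
     = (\<Sum>k\<le>n. \<Sum>j\<le>n. of_nat ((2 * j) choose j) ^ 2 * ?y ^ j * (of_nat ((k + j) choose (2 * j))
       * (of_int d / \<mu>) ^ k))"
    unfolding atMost_atLeast0[symmetric]
  proof (intro sum.cong refl)
    fix k assume "k \<in> {..n}"
    then show "of_int (trinomial_T k b c) ^ 2 / \<mu> ^ k = (\<Sum>j\<le>n. of_nat ((2 * j) choose j) ^ 2 * ?y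
      ^ j * (of_nat ((k + j) choose (2 * j)) * (of_int d / \<mu>) ^ k))"
      using trinomial_T_square[OF d, of k n]
      by (simp add: clausen_coeff_def sum_distrib_left sum_divide_distrib power_divide mult_ac)
  qed
  also have "\<dots> = (\<Sum>j\<le>n. of_nat ((2 * j) choose j) ^ 2 * ?y ^ j * shifted_gf (Suc n) j (of_int d
    / \<mu>))"
    unfolding shifted_gf_def lessThan_Suc_atMost sum_distrib_left by (rule sum.swap)
  finally show ?thesis .
qed

section \<open>Evaluation of the weighted sum of reciprocals\<close>

text \<open>The coefficients of the shifted Legendre polynomial P_h(1 - 2x).\<close>

definition legendre_coeff :: "nat \<Rightarrow> nat \<Rightarrow> rat" where
  "legendre_coeff h j = (-1) ^ j * of_nat ((h + j) choose (2 * j)) * of_nat ((2 * j) choose j)"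

section \<open>The Chebyshev polynomials U_(n-1) and V_n (third kind) at 1 + z/2, expanded in powers
  of z\<close>

definition odd_cheb :: "rat \<Rightarrow> nat \<Rightarrow> rat" where
  "odd_cheb z n = (\<Sum>i<n. of_nat ((n + i) choose (2 * i + 1)) * z ^ i)"

definition even_cheb :: "rat \<Rightarrow> nat \<Rightarrow> rat" where
  "even_cheb z n = (\<Sum>i\<le>n. of_nat ((n + i) choose (2 * i)) * z ^ i)"

lemma odd_cheb_Suc: "odd_cheb z (Suc n) = odd_cheb z n + even_cheb z n"
proof -
  have "odd_cheb z (Suc n) = (\<Sum>i\<le>n. (of_nat ((n + i) choose (2 * i + 1)) + of_nat ((n + i) choose (2 *
    i))) * z ^ i)"
    unfolding odd_cheb_def lessThan_Suc_atMost by (intro sum.cong) simp_all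
  also have "\<dots> = (\<Sum>i\<le>n. of_nat ((n + i) choose (2 * i + 1)) * z ^ i) + even_cheb z n"
    unfolding even_cheb_def by (simp add: sum.distrib algebra_simps)
  also have "(\<Sum>i\<le>n. of_nat ((n + i) choose (2 * i + 1)) * z ^ i) = odd_cheb z n"
    unfolding odd_cheb_def lessThan_Suc_atMost[symmetric] by (simp add: mult_2)
  finally show ?thesis .
qed

lemma even_cheb_Suc: "even_cheb z (Suc n) = even_cheb z n + z * odd_cheb z (Suc n)"
proof -
  have eq: "(Suc n + Suc i) choose (2 * Suc i) = ((n + Suc i) choose (2 * Suc i)) + ((Suc n + i) choose (2 * i
    + 1))" for i
    by simp
  have "even_cheb z (Suc n) = 1 + (\<Sum>i\<le>n. of_nat ((Suc n + Suc i) choose (2 * Suc i)) * z ^ Suc i)"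
    unfolding even_cheb_def sum.atMost_Suc_shift by simp
  also have "\<dots> = (1 + (\<Sum>i\<le>n. of_nat ((n + Suc i) choose (2 * Suc i)) * z ^ Suc i)) + z *
    odd_cheb z (Suc n)"
    unfolding eq odd_cheb_def lessThan_Suc_atMost
    by (simp add: sum.distrib sum_distrib_left algebra_simps del: binomial_Suc_Suc)
  also have "1 + (\<Sum>i\<le>n. of_nat ((n + Suc i) choose (2 * Suc i)) * z ^ Suc i) = (\<Sum>i\<le>Suc n.
    of_nat ((n + i) choose (2 * i)) * z ^ i)"
    unfolding sum.atMost_Suc_shift by simp
  also have "\<dots> = even_cheb z n"
    unfolding even_cheb_def by (simp add: binomial_eq_0 del: binomial_Suc_Suc)
  finally show ?thesis .
qed

text \<open>Both formulas are proved together, since the two recurrences feed each other. Keeping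
  the factors 1/t - t and 1 + t on the left allows t = 1 and t = -1.\<close>

lemma cheb_closed_form:
  fixes t :: rat
  assumes "t \<noteq> 0"
  defines "z \<equiv> (1 - t) ^ 2 / t"
  shows "(1 / t - t) * odd_cheb z n = (1 / t) ^ n - t ^ n"
    and "(1 + t) * even_cheb z n = (1 / t) ^ n + t ^ Suc n"
proof (induction n)
  case 0
  { case 1 show ?case by (simp add: odd_cheb_def)
  next case 2 show ?case by (simp add: even_cheb_def) }
next
  case (Suc n)
  define s where "s = 1 / t"
  define P Q where "P = s ^ n" and "Q = t ^ n"
  have st: "s * t = 1" using assms by (simp add: s_def)
  have z: "z = s * (1 - t) ^ 2" by (simp add: z_def s_def)
  have IH: "(s - t) * odd_cheb z n = P - Q" "(1 + t) * even_cheb z n = P + t * Q"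
    using Suc by (simp_all add: s_def P_def Q_def)
  have odd: "(s - t) * odd_cheb z (Suc n) = s * P - t * Q"
    unfolding odd_cheb_Suc using IH st by Groebner_Basis.algebra
  have even: "(1 + t) * even_cheb z (Suc n) = s * P + t * (t * Q)"
  proof -
    \<comment> \<open>This converts the factor 1 + t of the even formula into the factor s - t of
      the odd one.\<close>
    have "(1 + t) * z = (1 - t) * (s - t)" using z st by Groebner_Basis.algebra
    then have "(1 + t) * even_cheb z (Suc n) = (P + t * Q) + (1 - t) * (s * P - t * Q)"
      unfolding even_cheb_Suc using IH odd by Groebner_Basis.algebra
    then show ?thesis using st by Groebner_Basis.algebra
  qed
  { case 1 show ?case using odd by (simp add: s_def P_def Q_def)
  next case 2 show ?case using even by (simp add: s_def P_def Q_def) }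
qed

section \<open>Abel summation of the weighted reciprocals\<close>

definition recip_coeff :: "nat \<Rightarrow> rat" where
  "recip_coeff i = (-1) ^ i / (of_nat i * of_nat ((2 * i) choose i))"

definition recip_poly :: "rat \<Rightarrow> nat \<Rightarrow> rat" where
  "recip_poly z j = (\<Sum>i<j. z ^ i * recip_coeff (Suc i))"

definition weighted_recip :: "rat \<Rightarrow> nat \<Rightarrow> rat" where
  "weighted_recip z h = (\<Sum>j\<le>h. legendre_coeff h j * recip_poly z j)"

definition abel_coeff :: "nat \<Rightarrow> nat \<Rightarrow> rat" where
  "abel_coeff n i = (-1) ^ i * of_nat (Suc i) * of_nat ((2 * Suc i) choose Suc i) * of_nat ((n + i) choose (2 *
    i + 1)) / of_nat n"

text \<open>Adding the coefficients of two consecutive degrees makes the partial sums a single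
  hypergeometric term, the weight that Abel summation needs.\<close>

lemma abel_coeff_sum:
  "(\<Sum>j\<le>i. legendre_coeff (Suc n) j + legendre_coeff n j) = abel_coeff (Suc n) i"
proof (induction i)
  case 0
  have "(1 + of_nat n :: rat) \<noteq> 0" by (simp add: add_nonneg_eq_0_iff)
  then show ?case by (simp add: legendre_coeff_def abel_coeff_def field_simps)
next
  case (Suc i)
  define N I where "N = (of_nat n :: rat)" and "I = (of_nat i :: rat)"
  have pos: "N + 1 > 0" "I + 1 > 0" "I + 2 > 0" "2 * I + 3 > 0" unfolding N_def I_def by (simp_all add:
    add_nonneg_pos)
  define A B C where "A = (of_nat ((Suc n + i) choose (2 * i + 1)) :: rat)"
    and "B = (of_nat ((Suc n + i) choose (2 * i + 2)) :: rat)" and "C = (of_nat ((2 * Suc i) choose Suc i) :: rat)"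
  have 1: "of_nat ((Suc n + Suc i) choose (2 * Suc i)) = A + B"
    by (simp add: A_def B_def)
  have 2: "of_nat ((n + Suc i) choose (2 * Suc i)) = B"
    by (simp add: B_def)
  have BA: "B * (2 * (I + 1)) = A * (N - I)"
    using choose_Suc_eq[of "Suc n + i" "2 * i + 1"] by (simp add: A_def B_def N_def I_def algebra_simps)
  have 3: "of_nat ((Suc n + Suc i) choose (2 * Suc i + 1)) * (2 * I + 3) = (A + B) * (N - I)"
  proof -
    have "of_nat ((Suc n + Suc i) choose (2 * Suc i + 1)) * (of_nat (2 * Suc i) + 1) = (A + B) * (of_nat (Suc n
      + Suc i) - of_nat (2 * Suc i))"
      unfolding 1[symmetric] using choose_Suc_eq[of "Suc n + Suc i" "2 * Suc i"] by (simp only: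
        Suc_eq_plus1[symmetric])
    moreover have "of_nat (2 * Suc i) + 1 = 2 * I + 3" "of_nat (Suc n + Suc i) - of_nat (2 * Suc i) = N - I"
      by (simp_all add: N_def I_def)
    ultimately show ?thesis by metis
  qed
  have 4: "(I + 2) * of_nat ((2 * Suc (Suc i)) choose Suc (Suc i)) = 2 * (2 * I + 3) * C"
    using central_binomial_Suc[of "Suc i"] by (simp add: C_def I_def algebra_simps)
  define E F where "E = (of_nat ((Suc n + Suc i) choose (2 * Suc i + 1)) :: rat)"
    and "F = (of_nat ((2 * Suc (Suc i)) choose Suc (Suc i)) :: rat)"
  have E: "E = (A + B) * (N - I) / (2 * I + 3)" and F: "F = 2 * (2 * I + 3) * C / (I + 2)"
    and B: "B = A * (N - I) / (2 * (I + 1))"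
    using 3 4 BA pos unfolding E_def[symmetric] F_def[symmetric] by (simp_all add: nonzero_eq_divide_eq mult.commute)
  have "(-1) ^ i * (I + 1) * C * A / (N + 1) + ((-1) ^ Suc i * (A + B) * C + (-1) ^ Suc i * B * C)
     = (-1) ^ Suc i * (I + 2) * F * E / (N + 1)"
  proof -
    have "(I + 1) * C * A / (N + 1) - ((A + B) * C + B * C) = - (I + 2) * F * E / (N + 1)"
      unfolding E F using pos BA by (simp add: divide_simps) Groebner_Basis.algebra
    then have "(-1) ^ i * ((I + 1) * C * A / (N + 1) - ((A + B) * C + B * C)) = (-1) ^ i * (- (I + 2) * F * E /
      (N + 1))"
      by (rule arg_cong)
    then show ?thesis by (simp add: algebra_simps)
  qed
  then show ?case
    using Suc.IH unfolding sum.atMost_Suc legendre_coeff_def 1 2 abel_coeff_def A_def[symmetric]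
      C_def[symmetric] E_def[symmetric] F_def[symmetric]
    by (simp add: N_def I_def add_ac)
qed

lemma legendre_coeff_eq_0: "h < j \<Longrightarrow> legendre_coeff h j = 0"
  by (simp add: legendre_coeff_def)

text \<open>The central binomials cancel and the signs combine to -1. What remains is a coefficient
  of \<open>odd_cheb\<close>, which is why the weighted sum has a closed form.\<close>

lemma abel_coeff_recip: 
  "abel_coeff n i * recip_coeff (Suc i) = - of_nat ((n + i) choose (2 * i + 1)) / of_nat n"
proof -
  have "(2 * Suc i) choose Suc i \<noteq> 0" by (simp del: mult_Suc_right binomial_Suc_Suc)
  then show ?thesis
    by (simp add: abel_coeff_def recip_coeff_def field_simps power_add[symmetric] mult_2[symmetric]
       del: mult_Suc_right binomial_Suc_Suc of_nat_Suc)
qed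

text \<open>This is P_h(-1). Consecutive values add up to a full Abel sum, which vanishes because
  its last binomial does.\<close>

lemma sum_legendre_coeff: "(\<Sum>j\<le>h. legendre_coeff h j) = (-1) ^ h"
proof (induction h)
  case 0
  show ?case by (simp add: legendre_coeff_def)
next
  case (Suc h)
  have "(\<Sum>j\<le>Suc h. legendre_coeff (Suc h) j) + (\<Sum>j\<le>Suc h. legendre_coeff h j) = abel_coeff
    (Suc h) (Suc h)"
    unfolding sum.distrib[symmetric] by (rule abel_coeff_sum)
  also have "\<dots> = 0" by (simp add: abel_coeff_def binomial_eq_0 del: binomial_Suc_Suc)
  finally show ?case using Suc.IH by (simp add: legendre_coeff_eq_0)
qed

lemma weighted_recip_Suc:
  "weighted_recip z (Suc n) + weighted_recip z n = odd_cheb z (Suc n) / of_nat (Suc n)"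
proof -
  define u where "u j = legendre_coeff (Suc n) j + legendre_coeff n j" for j
  \<comment> \<open>Summation by parts up to m: a boundary term plus partial sums times increments
    of \<open>recip_poly\<close>. At m = \<open>Suc n\<close> the boundary term is zero.\<close>
  have abel: "(\<Sum>j\<le>m. u j * recip_poly z j) =
     abel_coeff (Suc n) m * recip_poly z m + (\<Sum>i<m. of_nat ((Suc n + i) choose (2 * i + 1)) * z ^ i) /
       of_nat (Suc n)" for m
  proof (induction m)
    case 0
    show ?case by (simp add: recip_poly_def)
  next
    case (Suc m)
    have "abel_coeff (Suc n) (Suc m) = abel_coeff (Suc n) m + u (Suc m)"
      unfolding abel_coeff_sum[symmetric] u_def by simp
    moreover have "recip_poly z (Suc m) = recip_poly z m + z ^ m * recip_coeff (Suc m)"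
      by (simp add: recip_poly_def)
    moreover note abel_coeff_recip[of "Suc n" m]
    moreover have "a * Q + s + u' * Q' = a' * Q' + (s + x * z ^ m / k)"
      if "a' = a + u'" "Q' = Q + z ^ m * r" "a * r = - x / k" for a a' Q Q' r s u' x k :: rat
    proof -
      have "a * Q + s + u' * Q' = a' * Q' + (s + (- (a * r)) * z ^ m)"
        unfolding that(1,2) by (simp add: algebra_simps)
      then show ?thesis by (simp add: that(3))
    qed
    ultimately show ?case unfolding sum.atMost_Suc Suc.IH sum.lessThan_Suc add_divide_distrib by blast
  qed
  have "weighted_recip z (Suc n) + weighted_recip z n = (\<Sum>j\<le>Suc n. u j * recip_poly z j)"
    unfolding weighted_recip_def u_def by (simp add: algebra_simps sum.distrib legendre_coeff_eq_0)
  also have "\<dots> = odd_cheb z (Suc n) / of_nat (Suc n)"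
    unfolding abel odd_cheb_def by (simp add: abel_coeff_def binomial_eq_0 del: binomial_Suc_Suc)
  finally show ?thesis .
qed

text \<open>Solves the first-order recurrence from the value 0 at h = 0; its alternating sign
  produces the powers of -1.\<close>

lemma weighted_recip_closed_form:
  fixes t :: rat
  assumes "t \<noteq> 0"
  shows "(1 / t - t) * weighted_recip ((1 - t) ^ 2 / t) h
     = (-1) ^ h * (\<Sum>k=1..h. (-1) ^ k * ((1 / t) ^ k - t ^ k) / of_nat k)"
proof (induction h)
  case 0
  show ?case by (simp add: weighted_recip_def recip_poly_def)
next
  case (Suc n)
  let ?z = "(1 - t) ^ 2 / t"
  have "(1 / t - t) * weighted_recip ?z (Suc n) = (1 / t - t) * odd_cheb ?z (Suc n) / of_nat (Suc n) - (1 / t -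
    t) * weighted_recip ?z n"
  proof -
    have "weighted_recip ?z (Suc n) = odd_cheb ?z (Suc n) / of_nat (Suc n) - weighted_recip ?z n"
      using weighted_recip_Suc[of ?z n] by linarith
    then show ?thesis by (simp add: right_diff_distrib del: of_nat_Suc)
  qed
  also have "\<dots> = ((1 / t) ^ Suc n - t ^ Suc n) / of_nat (Suc n)
       - (-1) ^ n * (\<Sum>k=1..n. (-1) ^ k * ((1 / t) ^ k - t ^ k) / of_nat k)"
    unfolding cheb_closed_form(1)[OF assms] Suc.IH ..
  also have "\<dots> = (-1) ^ Suc n * (\<Sum>k=1..Suc n. (-1) ^ k * ((1 / t) ^ k - t ^ k) / of_nat k)"
    by (simp add: algebra_simps del: of_nat_Suc power_Suc) (simp add: power_add[symmetric] mult_2[symmetric])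
  finally show ?case .
qed

text \<open>Serves to evaluate \<open>central_S\<close> modulo p. By induction on h, the increment
  is a full binomial expansion of (1 - x)^h divided by h.\<close>

lemma sum_choose_alternating_over:
  fixes x :: rat
  shows "(\<Sum>k=1..h. (-1) ^ k * of_nat (h choose k) * x ^ k / of_nat k) = (\<Sum>k=1..h. ((1 - x) ^ k - 1) /
    of_nat k)"
proof (induction h)
  case (Suc n)
  have "(\<Sum>k=1..Suc n. (-1) ^ k * of_nat (Suc n choose k) * x ^ k / of_nat k)
     = (\<Sum>k=1..Suc n. (-1) ^ k * of_nat (n choose k) * x ^ k / of_nat k
         + (-1) ^ k * of_nat (Suc n choose k) * x ^ k / of_nat (Suc n))"
  proof (intro sum.cong refl)
    fix k assume k: "k \<in> {1..Suc n}"
    have "(of_nat (Suc n) - of_nat k) * of_nat (Suc n choose k) = (of_nat (Suc n) :: rat) * of_nat (n choose k)"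
      using Suc_choose_eq[of n k] by (simp add: add_ac)
    \<comment> \<open>Division by k (n + 1) splits the term into the one for n and one without k in
      the denominator.\<close>
    then have "of_nat (Suc n choose k) / of_nat k = (of_nat (n choose k) / of_nat k + of_nat (Suc n choose k) /
      of_nat (Suc n) :: rat)"
      using k by (simp add: field_simps del: of_nat_Suc)
    then have "(-1) ^ k * x ^ k * (of_nat (Suc n choose k) / of_nat k) = (-1) ^ k * x ^ k * (of_nat (n choose
      k) / of_nat k + of_nat (Suc n choose k) / of_nat (Suc n))"
      by (rule arg_cong)
    then show "(-1) ^ k * of_nat (Suc n choose k) * x ^ k / of_nat k = (-1) ^ k * of_nat (n choose k) * x ^ k /
      of_nat k
         + (-1) ^ k * of_nat (Suc n choose k) * x ^ k / of_nat (Suc n)"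
      by (simp add: algebra_simps del: of_nat_Suc)
  qed
  also have "\<dots> = (\<Sum>k=1..n. (-1) ^ k * of_nat (n choose k) * x ^ k / of_nat k)
        + (\<Sum>k=1..Suc n. (-1) ^ k * of_nat (Suc n choose k) * x ^ k) / of_nat (Suc n)"
  proof -
    have "(\<Sum>k=1..Suc n. (-1) ^ k * of_nat (n choose k) * x ^ k / of_nat k) = (\<Sum>k=1..n. (-1) ^ k *
      of_nat (n choose k) * x ^ k / of_nat k)"
      by simp
    then show ?thesis unfolding sum.distrib sum_divide_distrib by (rule arg_cong)
  qed
  also have "(\<Sum>k=1..Suc n. (-1) ^ k * of_nat (Suc n choose k) * x ^ k) = (1 - x) ^ Suc n - 1"
  proof -
    have "(1 - x) ^ Suc n = (\<Sum>k\<le>Suc n. of_nat (Suc n choose k) * (- x) ^ k)"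
      using binomial_ring[of "- x" 1 "Suc n"] by simp
    also have "\<dots> = 1 + (\<Sum>k=1..Suc n. (-1) ^ k * of_nat (Suc n choose k) * x ^ k)"
      unfolding atMost_atLeast0
      by (subst sum.atLeast_Suc_atMost) (auto simp: power_minus[of x] mult_ac simp del: binomial_Suc_Suc power_Suc)
    finally show ?thesis by simp
  qed
  finally show ?case using Suc.IH by simp
qed simp

section \<open>Congruences of \<open>p\<close>-integral rationals\<close>

locale odd_prime =
  fixes p :: nat
  assumes prime: "prime p" and odd: "odd p"
begin

section \<open>Arithmetic of p-integral rationals\<close>

abbreviation pint :: "rat \<Rightarrow> bool" where "pint \<equiv> p_integral p"

abbreviation cong_pow :: "rat \<Rightarrow> nat \<Rightarrow> rat \<Rightarrow> bool"
  ("(_ \<equiv>\<^bsub>_\<^esub> _)" [51, 0, 51] 50) where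
  "x \<equiv>\<^bsub>e\<^esub> y \<equiv> padic_cong p e x y"

definition half :: nat where "half = (p - 1) div 2"

lemma p_eq: "p = 2 * half + 1"
  using odd by (auto simp: half_def elim: oddE)

lemma half_pos: "half > 0"
  using prime_gt_1_nat[OF prime] p_eq by linarith

text \<open>The reduced denominator divides every denominator of x. The closure rules can therefore
  use unreduced fractions.\<close>

lemma pint_iff: "pint x \<longleftrightarrow> (\<exists>a b. \<not> int p dvd b \<and> x = of_int a / of_int b)"
proof
  obtain a b where q: "quotient_of x = (a, b)" by force
  note ab = quotient_of_div[OF q] quotient_of_coprime[OF q] quotient_of_denom_pos[OF q]
  have prime': "prime (int p)" using prime by simp
  {
    assume "pint x"
    then have "coprime b (int p)" by (simp add: p_integral_def q)
    have "\<not> int p dvd b"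
    proof
      assume "int p dvd b"
      then have "is_unit (int p)" by (rule coprime_common_divisor[OF \<open>coprime b (int p)\<close>]) simp
      then show False using prime' not_prime_unit by metis
    qed
    then show "\<exists>a b. \<not> int p dvd b \<and> x = of_int a / of_int b" using ab by blast
  next
    assume "\<exists>a b. \<not> int p dvd b \<and> x = of_int a / of_int b"
    then obtain r s where rs: "\<not> int p dvd s" "x = of_int r / of_int s" by blast
    then have "s \<noteq> 0" by auto
    then have "of_int (a * s) = (of_int (r * b) :: rat)" using ab rs by (simp add: field_simps)
    then have "a * s = r * b" by (simp only: of_int_eq_iff)
    then have "b dvd a * s" by simp
    then have "b dvd s" using ab(2) coprime_dvd_mult_right_iff[of b a s] by (simp add: coprime_commute)
    then have "\<not> int p dvd b" using rs(1) dvd_trans by blast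
    then have "coprime b (int p)" using prime_imp_coprime[OF prime'] by (simp add: coprime_commute)
    then show "pint x" by (simp add: p_integral_def q)
  }
qed

lemma pint_of_int [simp, intro]: "pint (of_int a)"
  using prime_gt_1_nat[OF prime] unfolding pint_iff by (intro exI[of _ a] exI[of _ 1]) auto

lemma pint_of_nat [simp, intro]: "pint (of_nat a)"
  using pint_of_int[of "int a"] by simp

lemma pint_simps [simp]: "pint 0" "pint 1" "pint (numeral k)"
  using pint_of_int[of 0] pint_of_int[of 1] pint_of_int[of "numeral k"] by simp_all

lemma pint_mult [intro]: "pint x \<Longrightarrow> pint y \<Longrightarrow> pint (x * y)"
proof -
  assume "pint x" "pint y"
  then obtain a b c d where 1: "\<not> int p dvd b" "x = of_int a / of_int b" "\<not> int p dvd d" "y = of_int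
    c / of_int d"
    unfolding pint_iff by blast
  have "\<not> int p dvd b * d" using 1 prime by (simp add: prime_dvd_mult_iff)
  moreover have "x * y = of_int (a * c) / of_int (b * d)" using 1 by simp
  ultimately show ?thesis unfolding pint_iff by blast
qed

lemma pint_add [intro]: "pint x \<Longrightarrow> pint y \<Longrightarrow> pint (x + y)"
proof -
  assume "pint x" "pint y"
  then obtain a b c d where 1: "\<not> int p dvd b" "x = of_int a / of_int b" "\<not> int p dvd d" "y = of_int
    c / of_int d"
    unfolding pint_iff by blast
  have "\<not> int p dvd b * d" using 1 prime by (simp add: prime_dvd_mult_iff)
  moreover have "b \<noteq> 0" "d \<noteq> 0" using 1 by auto
  then have "x + y = of_int (a * d + c * b) / of_int (b * d)" using 1 by (simp add: field_simps)
  ultimately show ?thesis unfolding pint_iff by blast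
qed

lemma pint_minus [intro]: "pint x \<Longrightarrow> pint (- x)"
  using pint_mult[of "of_int (-1)" x] pint_of_int[of "-1"] by simp

lemma pint_diff [intro]: "pint x \<Longrightarrow> pint y \<Longrightarrow> pint (x - y)"
  using pint_add[of x "- y"] by auto

lemma pint_power [intro]: "pint x \<Longrightarrow> pint (x ^ n)"
  by (induction n) auto

lemma pint_sum [intro]: "(\<And>i. i \<in> A \<Longrightarrow> pint (f i)) \<Longrightarrow> pint (sum f A)"
  by (induction A rule: infinite_finite_induct) auto

lemma pint_divide_int [intro]: "pint x \<Longrightarrow> \<not> int p dvd b \<Longrightarrow> pint (x / of_int b)"
proof -
  assume "pint x" "\<not> int p dvd b"
  moreover have "pint (of_int 1 / of_int b)" unfolding pint_iff using \<open>\<not> int p dvd b\<close> by blast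
  ultimately show ?thesis using pint_mult by fastforce
qed

lemma pint_divide_nat [intro]: "pint x \<Longrightarrow> \<not> p dvd b \<Longrightarrow> pint (x / of_nat b)"
  using pint_divide_int[of x "int b"] by simp

lemma not_dvd_less: "0 < k \<Longrightarrow> k < p \<Longrightarrow> \<not> p dvd k"
  using dvd_imp_le by fastforce

lemma not_dvd_2_power: "\<not> p dvd 2 ^ n"
  using prime odd prime_dvd_power[OF prime, of 2 n] primes_dvd_imp_eq[OF prime two_is_prime_nat] by auto

section \<open>Calculus of congruences modulo powers of p\<close>

lemma cong_pint: "x \<equiv>\<^bsub>e\<^esub> y \<Longrightarrow> pint x" "x \<equiv>\<^bsub>e\<^esub> y
  \<Longrightarrow> pint y"
  by (simp_all add: padic_cong_def)

lemma congI: "pint y \<Longrightarrow> pint z \<Longrightarrow> x = y + of_nat p ^ e * z \<Longrightarrow> x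
  \<equiv>\<^bsub>e\<^esub> y"
  unfolding padic_cong_def by (auto intro!: pint_add pint_mult pint_power exI[of _ z])

lemma congE:
  assumes "x \<equiv>\<^bsub>e\<^esub> y"
  obtains z where "pint y" "pint z" "x = y + of_nat p ^ e * z"
  using assms unfolding padic_cong_def by (metis add.commute diff_add_cancel)

lemma cong_refl [simp, intro]: "pint x \<Longrightarrow> x \<equiv>\<^bsub>e\<^esub> x"
  by (rule congI[of _ 0]) auto

lemma cong_sym: "x \<equiv>\<^bsub>e\<^esub> y \<Longrightarrow> y \<equiv>\<^bsub>e\<^esub> x"
proof -
  assume xy: "x \<equiv>\<^bsub>e\<^esub> y"
  then obtain z where "pint y" "pint z" "x = y + of_nat p ^ e * z" by (rule congE)
  then show ?thesis using cong_pint[OF xy] by (intro congI[of _ "- z"]) auto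
qed

lemma cong_trans [trans]: "x \<equiv>\<^bsub>e\<^esub> y \<Longrightarrow> y \<equiv>\<^bsub>e\<^esub> z
  \<Longrightarrow> x \<equiv>\<^bsub>e\<^esub> z"
proof (elim congE)
  fix r s assume "x = y + of_nat p ^ e * r" "pint r" "y = z + of_nat p ^ e * s" "pint z" "pint s"
  then show ?thesis by (intro congI[of _ "s + r"]) (auto simp: algebra_simps)
qed

lemma cong_add: "x \<equiv>\<^bsub>e\<^esub> y \<Longrightarrow> u \<equiv>\<^bsub>e\<^esub> v
  \<Longrightarrow> x + u \<equiv>\<^bsub>e\<^esub> y + v"
proof (elim congE)
  fix r s assume "pint y" "pint r" "x = y + of_nat p ^ e * r" "pint v" "pint s" "u = v + of_nat p ^ e * s"
  then show ?thesis by (intro congI[of _ "r + s"]) (auto simp: algebra_simps)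
qed

lemma cong_mult: "x \<equiv>\<^bsub>e\<^esub> y \<Longrightarrow> u \<equiv>\<^bsub>e\<^esub> v
  \<Longrightarrow> x * u \<equiv>\<^bsub>e\<^esub> y * v"
proof (elim congE)
  fix r s assume "pint y" "pint r" "x = y + of_nat p ^ e * r" "pint v" "pint s" "u = v + of_nat p ^ e * s"
  then show ?thesis
    by (intro congI[of _ "y * s + r * v + of_nat p ^ e * r * s"]) (auto simp: algebra_simps intro!: pint_add
      pint_mult)
qed

lemma cong_mult_left: "pint a \<Longrightarrow> x \<equiv>\<^bsub>e\<^esub> y \<Longrightarrow> a * x
  \<equiv>\<^bsub>e\<^esub> a * y"
  by (intro cong_mult) auto

lemma cong_mult_right: "pint a \<Longrightarrow> x \<equiv>\<^bsub>e\<^esub> y \<Longrightarrow> x * a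
  \<equiv>\<^bsub>e\<^esub> y * a"
  by (intro cong_mult) auto

lemma cong_minus: "x \<equiv>\<^bsub>e\<^esub> y \<Longrightarrow> - x \<equiv>\<^bsub>e\<^esub> - y"
  using cong_mult_left[of "-1" e x y] pint_minus[of 1] by simp

lemma cong_diff: "x \<equiv>\<^bsub>e\<^esub> y \<Longrightarrow> u \<equiv>\<^bsub>e\<^esub> v
  \<Longrightarrow> x - u \<equiv>\<^bsub>e\<^esub> y - v"
  using cong_add[of e x y "- u" "- v"] cong_minus by simp

lemma cong_sum: "(\<And>i. i \<in> A \<Longrightarrow> f i \<equiv>\<^bsub>e\<^esub> g i) \<Longrightarrow> sum
  f A \<equiv>\<^bsub>e\<^esub> sum g A"
  by (induction A rule: infinite_finite_induct) (auto intro: cong_add)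

text \<open>Once a term carries a factor p, its cofactor matters only modulo p.\<close>

lemma cong_p_mult: "x \<equiv>\<^bsub>1\<^esub> y \<Longrightarrow> of_nat p * x \<equiv>\<^bsub>2\<^esub>
  of_nat p * y"
proof (elim congE)
  fix z assume "pint y" "pint z" "x = y + of_nat p ^ 1 * z"
  then show ?thesis by (intro congI[of _ z]) (auto simp: algebra_simps power2_eq_square)
qed

lemma cong_p_square: "pint z \<Longrightarrow> of_nat p ^ 2 * z \<equiv>\<^bsub>2\<^esub> 0"
  by (rule congI[of _ z]) auto

lemma cong_weaken: "x \<equiv>\<^bsub>2\<^esub> y \<Longrightarrow> x \<equiv>\<^bsub>1\<^esub> y"
proof (elim congE)
  fix z assume "pint y" "pint z" "x = y + of_nat p ^ 2 * z"
  then show ?thesis by (intro congI[of _ "of_nat p * z"]) (auto simp: power2_eq_square)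
qed

lemma cong_of_int: "int p ^ e dvd a - b \<Longrightarrow> of_int a \<equiv>\<^bsub>e\<^esub> of_int b"
proof -
  assume "int p ^ e dvd a - b"
  then obtain k where "a - b = int p ^ e * k" by blast
  then have "a = b + int p ^ e * k" by simp
  then show ?thesis by (intro congI[of _ "of_int k"]) auto
qed

section \<open>Central binomials and boundary binomials at p\<close>

lemma central_binomial_dvd:
  assumes "half < k" "k < p"
  shows "p dvd (2 * k) choose k"
proof -
  \<comment> \<open>Since k < p < 2k, the prime p divides (2k)! but not k!.\<close>
  have "p dvd fact (2 * k)" using assms p_eq by (simp add: prime_dvd_fact_iff[OF prime])
  moreover have "fact (2 * k) = fact k * fact k * ((2 * k) choose k)"
    using binomial_fact_lemma[of k "2 * k"] by (simp add: mult_2)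
  ultimately show ?thesis using assms prime
    by (simp add: prime_dvd_mult_iff prime_dvd_fact_iff)
qed

lemma central_binomial_not_dvd:
  assumes "k \<le> half"
  shows "\<not> p dvd (2 * k) choose k"
proof
  assume "p dvd (2 * k) choose k"
  then have "p dvd fact (2 * k)"
    using binomial_fact_lemma[of k "2 * k"] by (metis dvd_mult dvd_refl le_add1 mult_2 dvd_trans)
  then show False using assms p_eq by (simp add: prime_dvd_fact_iff[OF prime])
qed

lemma central_binomial_cong_0:
  assumes "half < k" "k < p"
  shows "of_nat ((2 * k) choose k) \<equiv>\<^bsub>1\<^esub> 0" "of_nat ((2 * k) choose k) ^ 2
    \<equiv>\<^bsub>2\<^esub> 0"
proof -
  obtain m where m: "(2 * k) choose k = p * m" using central_binomial_dvd[OF assms] by blast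
  show "of_nat ((2 * k) choose k) \<equiv>\<^bsub>1\<^esub> 0"
    unfolding m by (rule congI[of _ "of_nat m"]) auto
  show "of_nat ((2 * k) choose k) ^ 2 \<equiv>\<^bsub>2\<^esub> 0"
    unfolding m by (rule congI[of _ "of_nat m ^ 2"]) (auto simp: power_mult_distrib)
qed

lemma pint_recip_coeff: "0 < i \<Longrightarrow> i \<le> half \<Longrightarrow> pint (recip_coeff i)"
proof -
  assume i: "0 < i" "i \<le> half"
  have "\<not> p dvd i * ((2 * i) choose i)"
    using i central_binomial_not_dvd[of i] not_dvd_less[of i] p_eq prime by (simp add: prime_dvd_mult_iff)
  then have "pint ((-1) ^ i / of_nat (i * ((2 * i) choose i)))"
    by (intro pint_divide_nat pint_power pint_minus) auto
  then show ?thesis by (simp add: recip_coeff_def)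
qed

text \<open>Divisible by \<open>p\<close>; the boundary terms \<open>p + j + 1\<close> and \<open>p + j\<close>
  over \<open>2j + 2\<close> are the multiples of it
  by \<open>(p + j + 1) / (2j + 2)\<close> and \<open>(p - j - 1) / (2j + 2)\<close>.\<close>

definition mid_binomial :: "nat \<Rightarrow> rat" where
  "mid_binomial j = of_nat ((p + j) choose (2 * j + 1))"

text \<open>Consecutive values have ratio (p^2 - (j+1)^2) / (2 (j+1) (2j+3)). Without p^2 this is
  the ratio of consecutive \<open>recip_coeff\<close>, and at j = 0 both sides equal p.\<close>

lemma mid_binomial_cong: "j < half \<Longrightarrow> mid_binomial j \<equiv>\<^bsub>2\<^esub> - 2 * of_nat p *
  recip_coeff (Suc j)"
proof (induction j)
  case 0
  then show ?case by (simp add: mid_binomial_def recip_coeff_def)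
next
  case (Suc j)
  define P J where "P = (of_nat p :: rat)" and "J = (of_nat j :: rat)"
  define A B where "A = (of_nat ((p + j) choose (2 * j + 1)) :: rat)" and "B = (of_nat ((p + j) choose (2 * j +
    2)) :: rat)"
  have pos: "J + 1 > 0" "2 * J + 3 > 0" "J + 2 > 0" unfolding J_def by (simp_all add: add_nonneg_pos)
  have BA: "B * (2 * (J + 1)) = A * (P - J - 1)"
    using choose_Suc_eq[of "p + j" "2 * j + 1"] by (simp add: A_def B_def P_def J_def algebra_simps)
  have AB: "of_nat ((p + Suc j) choose (2 * j + 2)) = A + B" by (simp add: A_def B_def)
  have "mid_binomial (Suc j) * (2 * J + 3) = (A + B) * (P - J - 1)"
  proof -
    have "of_nat ((p + Suc j) choose Suc (2 * j + 2)) * (of_nat (2 * j + 2) + 1) = (A + B) * (of_nat (p + Suc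
      j) - of_nat (2 * j + 2))"
      unfolding AB[symmetric] by (rule choose_Suc_eq)
    moreover have "of_nat (2 * j + 2) + 1 = 2 * J + 3" "of_nat (p + Suc j) - of_nat (2 * j + 2) = P - J - 1"
      by (simp_all add: P_def J_def)
    moreover have "2 * Suc j + 1 = Suc (2 * j + 2)" by simp
    ultimately show ?thesis unfolding mid_binomial_def by metis
  qed
  then have eq: "mid_binomial (Suc j) = A * ((P + J + 1) * (P - J - 1) / (2 * (J + 1) * (2 * J + 3)))"
    using BA pos by (simp add: divide_simps) Groebner_Basis.algebra
  have A: "A = mid_binomial j" by (simp add: A_def mid_binomial_def)
  have den: "\<not> p dvd 2 * Suc j * (2 * j + 3)"
    using Suc.prems p_eq prime not_dvd_less[of 2] not_dvd_less[of "Suc j"] not_dvd_less[of "2 * j + 3"]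
    by (simp add: prime_dvd_mult_iff del: mult_Suc_right)
  have inv: "pint (x / (2 * (J + 1) * (2 * J + 3)))" if "pint x" for x
    using pint_divide_nat[OF that den] by (simp add: J_def algebra_simps)
  have rc: "recip_coeff (Suc (Suc j)) = - recip_coeff (Suc j) * (J + 1) / (2 * (2 * J + 3))"
  proof -
    define C E where "C = (of_nat ((2 * Suc j) choose Suc j) :: rat)" and "E = (of_nat ((2 * Suc (Suc j))
      choose Suc (Suc j)) :: rat)"
    have "(J + 2) * E = 2 * (2 * J + 3) * C"
      using central_binomial_Suc[of "Suc j"] by (simp add: C_def E_def J_def algebra_simps)
    then have E: "E = 2 * (2 * J + 3) * C / (J + 2)" using pos by (simp add: field_simps)
    have s: "of_nat (Suc j) = J + 1" "of_nat (Suc (Suc j)) = J + 2" by (simp_all add: J_def)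
    show ?thesis unfolding recip_coeff_def C_def[symmetric] E_def[symmetric] s E
      using pos by (simp add: divide_simps)
  qed
  have pr: "pint (recip_coeff (Suc j))" using Suc.prems by (intro pint_recip_coeff) auto
  have "mid_binomial (Suc j) \<equiv>\<^bsub>2\<^esub> (- 2 * P * recip_coeff (Suc j)) * ((P + J + 1) * (P - J
    - 1) / (2 * (J + 1) * (2 * J + 3)))"
    unfolding eq A P_def
    using Suc by (intro cong_mult cong_refl inv) (auto simp: J_def intro!: pint_mult pint_add pint_diff)
  also have "(- 2 * P * recip_coeff (Suc j)) * ((P + J + 1) * (P - J - 1) / (2 * (J + 1) * (2 * J + 3)))
     = - 2 * P * recip_coeff (Suc (Suc j)) + P ^ 2 * (- 2 * recip_coeff (Suc j) * (P / (2 * (J + 1) * (2 * J + 3))))"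
    unfolding rc using pos by (simp add: divide_simps) Groebner_Basis.algebra
  also have "\<dots> \<equiv>\<^bsub>2\<^esub> - 2 * P * recip_coeff (Suc (Suc j)) + 0"
    unfolding P_def using pr Suc.prems
    by (intro cong_add cong_refl cong_p_square pint_mult inv pint_minus pint_recip_coeff) auto
  finally show ?case by (simp add: P_def)
qed

section \<open>The two congruences\<close>

lemma pint_neg1 [simp]: "pint (- 1)"
  using pint_of_int[of "-1"] by simp

lemma pint_shifted_gf [intro]: "pint t \<Longrightarrow> pint (shifted_gf n j t)"
  unfolding shifted_gf_def by (intro pint_sum pint_mult pint_power) auto

text \<open>For (p - 1)/2 < j < p the central binomial is divisible by p, so its square removes the
  term modulo p^2.\<close>

lemma sum_trinomial_T_square_cong:
  fixes b c d :: int
  assumes d: "d = b ^ 2 - 4 * c" "\<not> int p dvd d" and t: "pint (of_int d / \<mu>)"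
  shows "(\<Sum>k=0..p-1. of_int (trinomial_T k b c) ^ 2 / \<mu> ^ k)
    \<equiv>\<^bsub>2\<^esub> (\<Sum>j\<le>half. of_nat ((2 * j) choose j) ^ 2 * (of_int c / of_int d) ^ j *
      shifted_gf p j (of_int d / \<mu>))"
proof -
  define g where "g j = of_nat ((2 * j) choose j) ^ 2 * (of_int c / of_int d) ^ j * shifted_gf p j (of_int d /
    \<mu>)" for j
  have pg: "pint ((of_int c / of_int d) ^ j * shifted_gf p j (of_int d / \<mu>))" for j
    using d(2) t by (intro pint_mult pint_power pint_divide_int pint_shifted_gf) auto
  have "d \<noteq> 0" using d(2) by auto
  then have "(\<Sum>k=0..p-1. of_int (trinomial_T k b c) ^ 2 / \<mu> ^ k) = (\<Sum>j\<le>p-1. g j)"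
    unfolding g_def using sum_trinomial_T_square[OF d(1), of \<mu> "p - 1"] p_eq by simp
  also have "\<dots> = (\<Sum>j\<le>half. g j) + (\<Sum>j\<in>{half<..p-1}. g j)"
  proof -
    have "{..p-1} = {..half} \<union> {half<..p-1}" using p_eq by auto
    then show ?thesis by (simp only:) (intro sum.union_disjoint, auto)
  qed
  also have "\<dots> \<equiv>\<^bsub>2\<^esub> (\<Sum>j\<le>half. g j) + (\<Sum>j\<in>{half<..p-1}. 0)"
  proof (rule cong_add[OF cong_refl cong_sum])
    show "pint (\<Sum>j\<le>half. g j)"
      unfolding g_def mult.assoc using pg by (intro pint_sum pint_mult[of "_ ^ 2"] pint_power) auto
  next
    fix j assume j: "j \<in> {half<..p-1}"
    then have "of_nat ((2 * j) choose j) ^ 2 \<equiv>\<^bsub>2\<^esub> 0"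
      using prime_gt_0_nat[OF prime] by (intro central_binomial_cong_0) auto
    from cong_mult_right[OF pg this] show "g j \<equiv>\<^bsub>2\<^esub> 0" by (simp add: g_def mult.assoc)
  qed
  finally show ?thesis by (simp add: g_def)
qed

section \<open>Boundary terms modulo p^2 and the case t = -1\<close>

lemma pint_half: "pint x \<Longrightarrow> pint (x / 2)"
  using pint_divide_nat[of x 2] not_dvd_2_power[of 1] by simp

lemma pint_quarter: "pint x \<Longrightarrow> pint (x / 4)"
  using pint_divide_nat[of x 4] not_dvd_2_power[of 2] by simp

text \<open>The factors multiplying \<open>mid_binomial j\<close> are 1/2 and -1/2, each increased
  by p / (2 (j+1)). The increase drops out modulo p^2 because \<open>mid_binomial j\<close> is
  itself divisible by p.\<close>

lemma boundary_binomials: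
  assumes "j < half"
  shows "of_nat ((p + Suc j) choose (2 * Suc j)) \<equiv>\<^bsub>2\<^esub> - of_nat p * recip_coeff (Suc j)"
    and "of_nat ((p + j) choose (2 * Suc j)) \<equiv>\<^bsub>2\<^esub> of_nat p * recip_coeff (Suc j)"
proof -
  define P J where "P = (of_nat p :: rat)" and "J = (of_nat j :: rat)"
  define r where "r = recip_coeff (Suc j)"
  have pos: "J + 1 > 0" unfolding J_def by (simp add: add_nonneg_pos)
  have M: "mid_binomial j \<equiv>\<^bsub>2\<^esub> - 2 * P * r"
    unfolding P_def r_def by (rule mid_binomial_cong[OF assms])
  have pr: "pint r" unfolding r_def using assms by (intro pint_recip_coeff) auto
  have "\<not> p dvd 2 * Suc j"
    using assms p_eq not_dvd_less[of "2 * Suc j"] by simp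
  then have inv: "pint (x / (2 * (J + 1)))" if "pint x" for x
    using pint_divide_nat[OF that, of "2 * Suc j"] by (simp add: J_def algebra_simps)
  have small: "P / (2 * (J + 1)) * mid_binomial j \<equiv>\<^bsub>2\<^esub> 0"
  proof -
    have "P / (2 * (J + 1)) * mid_binomial j \<equiv>\<^bsub>2\<^esub> P / (2 * (J + 1)) * (- 2 * P * r)"
      using M by (intro cong_mult_left inv) (auto simp: P_def)
    also have "P / (2 * (J + 1)) * (- 2 * P * r) = P ^ 2 * ((- 2 * r) / (2 * (J + 1)))"
      using pos by (simp add: field_simps power2_eq_square)
    also have "\<dots> \<equiv>\<^bsub>2\<^esub> 0"
      unfolding P_def using pr by (intro cong_p_square inv pint_mult pint_minus) auto
    finally show ?thesis .
  qed
  have half_mid: "1 / 2 * mid_binomial j \<equiv>\<^bsub>2\<^esub> - P * r"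
    using cong_mult_left[OF pint_half[of 1] M] by simp
  have "of_nat ((p + Suc j) choose (2 * Suc j)) * (2 * (J + 1)) = (P + J + 1) * mid_binomial j"
    using arg_cong[OF Suc_times_binomial[of "2 * j + 1" "p + j"], of "of_nat :: nat \<Rightarrow> rat"]
    by (simp add: mid_binomial_def P_def J_def algebra_simps)
  then have "of_nat ((p + Suc j) choose (2 * Suc j)) = 1 / 2 * mid_binomial j + P / (2 * (J + 1)) * mid_binomial j"
    using pos by (simp add: field_simps del: binomial_Suc_Suc)
  also have "\<dots> \<equiv>\<^bsub>2\<^esub> - P * r + 0" by (rule cong_add[OF half_mid small])
  finally show "of_nat ((p + Suc j) choose (2 * Suc j)) \<equiv>\<^bsub>2\<^esub> - of_nat p * recip_coeff (Suc j)"
    by (simp add: P_def r_def)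
  have "of_nat ((p + j) choose (2 * Suc j)) * (2 * (J + 1)) = (P - J - 1) * mid_binomial j"
    using choose_Suc_eq[of "p + j" "2 * j + 1"] by (simp add: mid_binomial_def P_def J_def algebra_simps)
  then have "of_nat ((p + j) choose (2 * Suc j)) = - (1 / 2 * mid_binomial j) + P / (2 * (J + 1)) * mid_binomial j"
    using pos by (simp add: field_simps del: binomial_Suc_Suc)
  also have "\<dots> \<equiv>\<^bsub>2\<^esub> - (- P * r) + 0" by (intro cong_add cong_minus half_mid small)
  finally show "of_nat ((p + j) choose (2 * Suc j)) \<equiv>\<^bsub>2\<^esub> of_nat p * recip_coeff (Suc j)"
    by (simp add: P_def r_def)
qed

lemma shifted_gf_neg1: "j \<le> half \<Longrightarrow> shifted_gf p j (- 1) \<equiv>\<^bsub>2\<^esub> (- 1 / 4) ^ j"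
proof (induction j)
  case 0
  have "shifted_gf p 0 (- 1) = (\<Sum>k<2 * half + 1. (- 1) ^ k)"
    unfolding shifted_gf_def p_eq[symmetric] by simp
  also have "(\<Sum>k<2 * n + 1. (- 1) ^ k) = (1 :: rat)" for n by (induction n) simp_all
  finally show ?case by simp
next
  case (Suc j)
  \<comment> \<open>As p is odd, both boundary terms enter with a plus sign at t = -1, and modulo
    p^2 they are negatives of each other.\<close>
  have "4 * shifted_gf p (Suc j) (- 1) = - shifted_gf p j (- 1)
     + of_nat ((p + Suc j) choose (2 * Suc j)) + of_nat ((p + j) choose (2 * Suc j))"
    using shifted_gf_Suc[of "- 1" p j] odd by (simp del: binomial_Suc_Suc mult_Suc_right add_Suc_right)
  also have "\<dots> \<equiv>\<^bsub>2\<^esub> - ((- 1 / 4) ^ j) + (- of_nat p * recip_coeff (Suc j)) + of_nat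
    p * recip_coeff (Suc j)"
    using Suc by (intro cong_add cong_minus boundary_binomials) auto
  finally have "1 / 4 * (4 * shifted_gf p (Suc j) (- 1)) \<equiv>\<^bsub>2\<^esub> 1 / 4 * - ((- 1 / 4) ^ j)"
    by (intro cong_mult_left pint_quarter) auto
  then show ?case by simp
qed

theorem sum_trinomial_T_square_neg_discriminant:
  fixes b c d :: int
  assumes d: "d = b ^ 2 - 4 * c" "\<not> int p dvd d"
  shows "(\<Sum>k=0..p-1. of_int (trinomial_T k b c) ^ 2 / (- of_int d) ^ k)
    \<equiv>\<^bsub>2\<^esub> (\<Sum>l=0..half. of_nat ((2 * l) choose l) ^ 2 * (- (of_int c / (4 * of_int d))) ^ l)"
proof -
  have t: "of_int d / - of_int d = (- 1 :: rat)" using d(2) by auto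
  have "(\<Sum>k=0..p-1. of_int (trinomial_T k b c) ^ 2 / (- of_int d) ^ k)
    \<equiv>\<^bsub>2\<^esub> (\<Sum>j\<le>half. of_nat ((2 * j) choose j) ^ 2 * (of_int c / of_int d) ^ j *
      shifted_gf p j (- 1))"
    using sum_trinomial_T_square_cong[OF d, of "- of_int d"] unfolding t by simp
  also have "\<dots> \<equiv>\<^bsub>2\<^esub> (\<Sum>j\<le>half. of_nat ((2 * j) choose j) ^ 2 * (of_int c /
    of_int d) ^ j * (- 1 / 4) ^ j)"
    using d(2) by (intro cong_sum cong_mult_left shifted_gf_neg1 pint_mult pint_power pint_divide_int) auto
  also have "\<dots> = (\<Sum>l=0..half. of_nat ((2 * l) choose l) ^ 2 * (- (of_int c / (4 * of_int d))) ^ l)"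
    unfolding atMost_atLeast0 mult.assoc power_mult_distrib[symmetric] by (simp add: mult.commute)
  finally show ?thesis .
qed

section \<open>Central binomials compared with binomials of (p - 1)/2\<close>

lemma two_half: "2 * (of_nat half :: rat) = of_nat p - 1"
  using arg_cong[OF p_eq, of "of_nat :: nat \<Rightarrow> rat"] by simp

text \<open>With h = (p - 1)/2 one has 4 (h - j)(h + j + 1) = p^2 - (2j + 1)^2. Only p^2 enters the
  ratio of consecutive terms, which is why the congruence holds modulo p^2.\<close>

lemma central_binomial_square_cong:
  "j \<le> half \<Longrightarrow> of_nat ((2 * j) choose j) ^ 2 / 16 ^ j \<equiv>\<^bsub>2\<^esub>
    legendre_coeff half j"
proof -
  \<comment> \<open>\<open>e\<close> is the Legendre coefficient without its central binomial, which
    is multiplied back at the end.\<close>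
  define e :: "nat \<Rightarrow> rat" where "e j = (-1) ^ j * of_nat ((half + j) choose (2 * j))" for j :: nat
  have "e j \<equiv>\<^bsub>2\<^esub> of_nat ((2 * j) choose j) / 16 ^ j" if "j \<le> half"
    using that
  proof (induction j)
    case 0
    show ?case by (simp add: e_def)
  next
    case (Suc j)
    define P J H where "P = (of_nat p :: rat)" and "J = (of_nat j :: rat)" and "H = (of_nat half :: rat)"
    define C E where "C = (of_nat ((2 * j) choose j) :: rat)" and "E = (of_nat ((2 * Suc j) choose Suc j) :: rat)"
    have pos: "J + 1 > 0" "2 * J + 1 > 0" unfolding J_def by (simp_all add: add_nonneg_pos)
    have H: "2 * H = P - 1" using two_half by (simp add: H_def P_def)
    have den: "\<not> p dvd 2 ^ 3 * Suc j * (2 * j + 1)"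
      using Suc.prems p_eq prime not_dvd_less[of "Suc j"] not_dvd_less[of "2 * j + 1"] not_dvd_2_power[of 3]
      by (simp add: prime_dvd_mult_iff del: mult_Suc_right)
    have inv: "pint (x / (8 * (J + 1) * (2 * J + 1)))" if "pint x" for x
      using pint_divide_nat[OF that den] by (simp add: J_def algebra_simps)
    have "E * (J + 1) = 2 * (2 * J + 1) * C"
      using central_binomial_Suc[of j] by (simp add: C_def E_def J_def mult.commute)
    then have E: "E = 2 * (2 * J + 1) * C / (J + 1)" using pos by (simp add: nonzero_eq_divide_eq)
    have "e (Suc j) * (2 * (J + 1) * (2 * J + 1)) = - e j * ((H - J) * (H + J + 1))"
      using choose_add_even_Suc_lower[of half j] unfolding e_def J_def H_def
      by (simp del: binomial_Suc_Suc mult_Suc_right add_Suc_right)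
    then have "e (Suc j) * (8 * (J + 1) * (2 * J + 1)) = e j * ((2 * J + 1) ^ 2 - P ^ 2)"
      using H by Groebner_Basis.algebra
    then have "e (Suc j) = e j * ((2 * J + 1) ^ 2 - P ^ 2) / (8 * (J + 1) * (2 * J + 1))"
      using pos by (simp add: nonzero_eq_divide_eq)
    also have "\<dots> = e j * ((2 * J + 1) ^ 2 / (8 * (J + 1) * (2 * J + 1))) + P ^ 2 * (- e j / (8 * (J + 1)
      * (2 * J + 1)))"
      by (simp add: algebra_simps diff_divide_distrib)
    also have "\<dots> \<equiv>\<^bsub>2\<^esub> C / 16 ^ j * ((2 * J + 1) ^ 2 / (8 * (J + 1) * (2 * J + 1))) + 0"
      unfolding P_def using Suc
      by (intro cong_add cong_mult_right cong_p_square inv pint_power pint_add pint_mult pint_minus)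
        (auto simp: e_def C_def J_def intro!: pint_mult pint_power)
    also have "C / 16 ^ j * ((2 * J + 1) ^ 2 / (8 * (J + 1) * (2 * J + 1))) + 0 = E / 16 ^ Suc j"
    proof -
      have "(2 * J + 1) ^ 2 / (8 * (J + 1) * (2 * J + 1)) = (2 * J + 1) / (8 * (J + 1))"
        using pos by (simp add: power2_eq_square)
      then show ?thesis unfolding E using pos by (simp add: divide_simps) (simp add: algebra_simps)
    qed
    finally show ?case by (simp add: E_def)
  qed
  moreover assume "j \<le> half"
  ultimately have "of_nat ((2 * j) choose j) * e j \<equiv>\<^bsub>2\<^esub> of_nat ((2 * j) choose j) *
    (of_nat ((2 * j) choose j) / 16 ^ j)"
    by (intro cong_mult_left) auto
  then show ?thesis
    by - (rule cong_sym, simp add: e_def legendre_coeff_def power2_eq_square mult_ac)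
qed

text \<open>The left side is (-1)^j times the generalised binomial of -1/2 over j, and (p - 1)/2 is
  congruent to -1/2 modulo p.\<close>

lemma central_binomial_cong:
  "j \<le> half \<Longrightarrow> of_nat ((2 * j) choose j) / 4 ^ j \<equiv>\<^bsub>1\<^esub> (-1) ^ j * of_nat
    (half choose j)"
proof (induction j)
  case 0
  show ?case by simp
next
  case (Suc j)
  define P J H where "P = (of_nat p :: rat)" and "J = (of_nat j :: rat)" and "H = (of_nat half :: rat)"
  define C E where "C = (of_nat ((2 * j) choose j) :: rat)" and "E = (of_nat ((2 * Suc j) choose Suc j) :: rat)"
  define a where "a j = (-1) ^ j * (of_nat (half choose j) :: rat)" for j
  have pos: "J + 1 > 0" unfolding J_def by (simp add: add_nonneg_pos)
  have H: "2 * H = P - 1" using two_half by (simp add: H_def P_def)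
  have "\<not> p dvd 2 * Suc j" using Suc.prems p_eq not_dvd_less[of "2 * Suc j"] by simp
  then have inv: "pint (x / (2 * (J + 1)))" if "pint x" for x
    using pint_divide_nat[OF that, of "2 * Suc j"] by (simp add: J_def algebra_simps)
  have "E * (J + 1) = 2 * (2 * J + 1) * C"
    using central_binomial_Suc[of j] by (simp add: C_def E_def J_def mult.commute)
  then have E: "E = 2 * (2 * J + 1) * C / (J + 1)" using pos by (simp add: nonzero_eq_divide_eq)
  have "a (Suc j) * (J + 1) = - a j * (H - J)"
    using choose_Suc_eq[of half j] by (simp add: a_def J_def H_def)
  then have "a (Suc j) * (2 * (J + 1)) = a j * (2 * J + 1 - P)"
    using H by Groebner_Basis.algebra
  then have "a (Suc j) = a j * (2 * J + 1 - P) / (2 * (J + 1))"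
    using pos by (simp add: nonzero_eq_divide_eq)
  then have aj: "a (Suc j) = a j * ((2 * J + 1) / (2 * (J + 1))) + P ^ 1 * (- a j / (2 * (J + 1)))"
    by (simp add: right_diff_distrib diff_divide_distrib mult.commute)
  have pa: "pint (a j)" unfolding a_def by (intro pint_mult pint_power) auto
  have pj: "pint (2 * J + 1)" unfolding J_def by (intro pint_add pint_mult) auto
  have "E / 4 ^ Suc j = C / 4 ^ j * ((2 * J + 1) / (2 * (J + 1)))"
    unfolding E using pos by (simp add: divide_simps) (simp add: algebra_simps)
  also have "\<dots> \<equiv>\<^bsub>1\<^esub> a j * ((2 * J + 1) / (2 * (J + 1)))"
    unfolding a_def C_def using Suc by (intro cong_mult_right inv pj) auto
  also have "\<dots> \<equiv>\<^bsub>1\<^esub> a (Suc j)"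
    unfolding aj P_def
    by (rule cong_sym, rule congI[OF pint_mult[OF pa inv[OF pj]] inv[OF pint_minus[OF pa]] refl])
  finally show ?case by (simp only: E_def a_def)
qed

text \<open>Terms beyond (p - 1)/2 vanish modulo p. In the others the central binomial over 4^k
  becomes a signed binomial, and the alternating sum is evaluated at 1 + t.\<close>

lemma central_S_cong:
  assumes t: "pint t"
  shows "central_S (p - 1) ((1 + t) / 4) \<equiv>\<^bsub>1\<^esub> (\<Sum>k=1..half. ((- t) ^ k - 1) / of_nat k)"
proof -
  define g where "g k = of_nat ((2 * k) choose k) / of_nat k * ((1 + t) / 4) ^ k" for k
  have "central_S (p - 1) ((1 + t) / 4) = (\<Sum>k=1..half. g k) + (\<Sum>k\<in>{half<..p-1}. g k)"
  proof -
    have "{1..p-1} = {1..half} \<union> {half<..p-1}" using p_eq by auto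
    then show ?thesis unfolding central_S_def g_def by (simp only:) (intro sum.union_disjoint, auto)
  qed
  also have "\<dots> \<equiv>\<^bsub>1\<^esub> (\<Sum>k=1..half. (-1) ^ k * of_nat (half choose k) * (1 + t) ^
    k / of_nat k) + (\<Sum>k\<in>{half<..p-1}. 0)"
  proof (intro cong_add cong_sum)
    fix k assume k: "k \<in> {1..half}"
    then have ndvd: "\<not> p dvd k" using p_eq not_dvd_less[of k] by simp
    have "(1 + t) ^ k / of_nat k * (of_nat ((2 * k) choose k) / 4 ^ k) \<equiv>\<^bsub>1\<^esub> (1 + t) ^ k /
      of_nat k * ((-1) ^ k * of_nat (half choose k))"
      using k t ndvd by (intro cong_mult_left central_binomial_cong pint_divide_nat pint_power pint_add) auto
    then show "g k \<equiv>\<^bsub>1\<^esub> (-1) ^ k * of_nat (half choose k) * (1 + t) ^ k / of_nat k"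
      by (simp add: g_def power_divide mult_ac)
  next
    fix k assume k: "k \<in> {half<..p-1}"
    then have "0 < k" "k < p" using prime_gt_0_nat[OF prime] by auto
    then have ndvd: "\<not> p dvd k" by (rule not_dvd_less)
    have "1 / of_nat k * ((1 + t) / 4) ^ k * of_nat ((2 * k) choose k) \<equiv>\<^bsub>1\<^esub> 1 / of_nat k *
      ((1 + t) / 4) ^ k * 0"
      using k t ndvd \<open>k < p\<close>
      by (intro cong_mult_left central_binomial_cong_0 pint_mult pint_divide_nat pint_power pint_quarter
        pint_add) auto
    then show "g k \<equiv>\<^bsub>1\<^esub> 0" by (simp add: g_def mult_ac)
  qed
  also have "\<dots> = (\<Sum>k=1..half. ((- t) ^ k - 1) / of_nat k)"
    using sum_choose_alternating_over[of half "1 + t"] by simp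
  finally show ?thesis .
qed

section \<open>Iterating the recurrence in j for general t\<close>

lemma shifted_gf_cong:
  assumes t: "pint t" "pint (1 / t)" "t \<noteq> 0" "t ^ (p - 1) \<equiv>\<^bsub>1\<^esub> 1"
  defines "z \<equiv> (1 - t) ^ 2 / t"
  shows "j \<le> half \<Longrightarrow> z ^ j * shifted_gf p j t \<equiv>\<^bsub>2\<^esub> shifted_gf p 0 t +
    of_nat p * ((1 + t) * recip_poly z j)"
proof (induction j)
  case 0
  show ?case using t by (auto simp: recip_poly_def)
next
  case (Suc j)
  define u l r where "u = (of_nat ((p + Suc j) choose (2 * Suc j)) :: rat)"
    and "l = (of_nat ((p + j) choose (2 * Suc j)) :: rat)" and "r = recip_coeff (Suc j)"
  have z: "z = (1 - t) ^ 2 * (1 / t)" by (simp add: z_def)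
  have pz: "pint z" unfolding z using t by (intro pint_mult pint_power pint_diff) auto
  have pr: "pint r" unfolding r_def using Suc.prems by (intro pint_recip_coeff) auto
  have tp: "t ^ p = t * t ^ (p - 1)" using p_eq by (simp flip: power_Suc)
  have "(1 - t) ^ 2 * shifted_gf p (Suc j) t = t * (shifted_gf p j t - t ^ (p - 1) * (u - t * l))"
    using shifted_gf_Suc[of t p j] unfolding u_def[symmetric] l_def[symmetric] power_Suc tp
    by (simp add: algebra_simps)
  \<comment> \<open>The recurrence divided by t. Both boundary binomials are divisible by p, so
    t^(p-1) may be replaced by 1, and each step contributes p (1 + t) z^j \<open>r\<close>.\<close>
  then have "z * shifted_gf p (Suc j) t = shifted_gf p j t - t ^ (p - 1) * (u - t * l)"
    unfolding z_def using t(3) by (simp add: field_simps)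
  then have "z ^ Suc j * shifted_gf p (Suc j) t = z ^ j * (shifted_gf p j t - t ^ (p - 1) * (u - t * l))"
    by (simp add: mult.assoc mult.left_commute)
  also have "\<dots> = z ^ j * shifted_gf p j t - z ^ j * (t ^ (p - 1) * (u - t * l))"
    by (simp add: right_diff_distrib)
  also have "\<dots> \<equiv>\<^bsub>2\<^esub> (shifted_gf p 0 t + of_nat p * ((1 + t) * recip_poly z j)) - z ^
    j * (of_nat p * (- (r * (1 + t))))"
  proof (intro cong_diff cong_mult_left pint_power pz)
    show "z ^ j * shifted_gf p j t \<equiv>\<^bsub>2\<^esub> shifted_gf p 0 t + of_nat p * ((1 + t) * recip_poly z j)"
      using Suc by simp
    have "t ^ (p - 1) * (u - t * l) \<equiv>\<^bsub>2\<^esub> t ^ (p - 1) * (- of_nat p * r - t * (of_nat p * r))"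
      unfolding u_def l_def r_def using Suc.prems t
      by (intro cong_mult_left cong_diff boundary_binomials pint_power) auto
    also have "\<dots> = of_nat p * (t ^ (p - 1) * (- (r * (1 + t))))"
      by (simp add: algebra_simps)
    also have "\<dots> \<equiv>\<^bsub>2\<^esub> of_nat p * (1 * (- (r * (1 + t))))"
      using t pr by (intro cong_p_mult cong_mult_right pint_minus pint_mult pint_add) auto
    finally show "t ^ (p - 1) * (u - t * l) \<equiv>\<^bsub>2\<^esub> of_nat p * (- (r * (1 + t)))" by simp
  qed
  also have "\<dots> = shifted_gf p 0 t + of_nat p * ((1 + t) * recip_poly z (Suc j))"
    by (simp add: recip_poly_def r_def algebra_simps)
  finally show ?case .
qed

text \<open>After the weights become Legendre coefficients, the part independent of j is multiplied
  by their sum, and the rest is \<open>weighted_recip\<close> by definition.\<close>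

lemma weighted_shifted_gf_cong:
  assumes t: "pint t" "pint (1 / t)" "t \<noteq> 0" "t ^ (p - 1) \<equiv>\<^bsub>1\<^esub> 1"
  defines "z \<equiv> (1 - t) ^ 2 / t"
  shows "(\<Sum>j\<le>half. of_nat ((2 * j) choose j) ^ 2 * (z / 16) ^ j * shifted_gf p j t)
    \<equiv>\<^bsub>2\<^esub> (-1) ^ half * shifted_gf p 0 t + of_nat p * ((1 + t) * weighted_recip z half)"
proof -
  have pz: "pint z"
    using pint_mult[OF pint_power[OF pint_diff[OF pint_simps(2) t(1)], of 2] t(2)] by (simp add: z_def)
  have "(\<Sum>j\<le>half. of_nat ((2 * j) choose j) ^ 2 * (z / 16) ^ j * shifted_gf p j t)
     = (\<Sum>j\<le>half. (of_nat ((2 * j) choose j) ^ 2 / 16 ^ j) * (z ^ j * shifted_gf p j t))"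
    by (simp add: power_divide mult.assoc)
  also have "\<dots> \<equiv>\<^bsub>2\<^esub> (\<Sum>j\<le>half. legendre_coeff half j * (shifted_gf p 0 t +
    of_nat p * ((1 + t) * recip_poly z j)))"
    unfolding z_def using t by (intro cong_sum cong_mult central_binomial_square_cong shifted_gf_cong) auto
  also have "\<dots> = (\<Sum>j\<le>half. legendre_coeff half j) * shifted_gf p 0 t + of_nat p * ((1 + t) *
    weighted_recip z half)"
    by (simp add: weighted_recip_def algebra_simps sum.distrib sum_distrib_left sum_distrib_right)
  finally show ?thesis unfolding sum_legendre_coeff .
qed

section \<open>Fermat quotients and the quadratic character of -1\<close>

lemma fermat_cong:
  assumes "\<not> int p dvd a"
  shows "of_int (a ^ (p - 1)) \<equiv>\<^bsub>1\<^esub> 1"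
proof -
  have "prime (int p)" using prime by simp
  have "\<not> p dvd nat \<bar>a\<bar>" using assms by (simp add: int_dvd_int_iff[symmetric] flip: int_dvd_int_iff)
  then have "[nat \<bar>a\<bar> ^ (p - 1) = 1] (mod p)" by (rule fermat_theorem[OF prime])
  then have "[int (nat \<bar>a\<bar> ^ (p - 1)) = int 1] (mod int p)" by (simp only: cong_int_iff)
  moreover have "int (nat \<bar>a\<bar> ^ (p - 1)) = a ^ (p - 1)"
    using odd by (simp add: power_even_abs)
  ultimately have "int p ^ 1 dvd a ^ (p - 1) - 1" by (simp add: cong_iff_dvd_diff)
  from cong_of_int[OF this] show ?thesis by simp
qed

text \<open>Euler's criterion gives the congruence modulo p. Both sides are 1 or -1, and p does not
  divide 2, so they are equal.\<close>

lemma Legendre_neg1: "Legendre (-1) (int p) = (-1) ^ half"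
proof -
  have p2: "2 < p" using p_eq half_pos by linarith
  have cong: "[Legendre (-1) (int p) = (-1) ^ half] (mod int p)"
    using euler_criterion[OF prime p2, of "-1"] by (simp add: half_def)
  have "\<not> [-1 = 0] (mod int p)" using p2 by (simp add: cong_iff_dvd_diff)
  then have "Legendre (-1) (int p) = 1 \<or> Legendre (-1) (int p) = -1" by (simp add: Legendre_def)
  moreover have "(-1 :: int) ^ half = 1 \<or> (-1 :: int) ^ half = -1" by (cases "even half") auto
  moreover have "\<not> int p dvd 2" "\<not> int p dvd - 2"
    using p2 zdvd_imp_le[of "int p" 2] by auto
  ultimately show ?thesis using cong by (auto simp: cong_iff_dvd_diff)
qed

lemma quotient_power_cong:
  assumes d: "\<not> int p dvd d" and m: "\<not> int p dvd m"
  shows "(of_int d / of_int m) ^ (p - 1) - 1 \<equiv>\<^bsub>2\<^esub> of_int d ^ (p - 1) - of_int m ^ (p - 1)"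
proof -
  define D M where "D = (of_int (d ^ (p - 1)) :: rat)" and "M = (of_int (m ^ (p - 1)) :: rat)"
  obtain u where u: "pint u" "D = 1 + of_nat p ^ 1 * u" using fermat_cong[OF d] unfolding D_def by (rule congE)
  obtain v where v: "pint v" "M = 1 + of_nat p ^ 1 * v" using fermat_cong[OF m] unfolding M_def by (rule congE)
  have M0: "M \<noteq> 0" using m by (auto simp: M_def)
  have "\<not> int p dvd m ^ (p - 1)"
    using m prime prime_dvd_power[of "int p" m "p - 1"] by auto
  then have inv: "pint (x / M)" if "pint x" for x using that unfolding M_def by (rule pint_divide_int[rotated])
  \<comment> \<open>D - M and 1 - M are both divisible by p, so replacing (D - M)/M by D - M costs a
    multiple of p^2; the witness is their product over p^2 M.\<close>
  have "(of_int d / of_int m) ^ (p - 1) - 1 = (D - M) + of_nat p ^ 2 * ((v - u) * v / M)"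
  proof -
    have "(of_int d / of_int m) ^ (p - 1) - 1 = (D - M) / M"
      using M0 by (simp add: D_def M_def power_divide diff_divide_distrib)
    also have "D - M = (D - M) * M + of_nat p ^ 2 * ((v - u) * v)" using u(2) v(2) by Groebner_Basis.algebra
    finally show ?thesis using M0 by (simp add: add_divide_distrib)
  qed
  then have "(of_int d / of_int m) ^ (p - 1) - 1 \<equiv>\<^bsub>2\<^esub> D - M"
    using u(1) v(1) by (intro congI[of _ "(v - u) * v / M"] inv pint_mult pint_diff) (auto simp: D_def M_def)
  then show ?thesis by (simp add: D_def M_def)
qed

theorem sum_trinomial_T_square_quadratic_parameter:
  fixes b c d m :: int
  assumes d: "d = b ^ 2 - 4 * c" and m: "(m - d) ^ 2 = 16 * m * c" "\<not> int p dvd m * d * (m - d)"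
  shows "(\<Sum>k=0..p-1. of_int (trinomial_T k b c) ^ 2 / of_int m ^ k)
    \<equiv>\<^bsub>2\<^esub> of_int (Legendre (-1) (int p))
      + of_nat p * of_int d / of_int (d - m) * of_int (Legendre (-1) (int p))
        * (fermat_quotient p d - fermat_quotient p m
           + central_S (p - 1) (of_int (m + d) / (4 * of_int m))
           - central_S (p - 1) (of_int (m + d) / (4 * of_int d)))"
    (is "_ \<equiv>\<^bsub>2\<^esub> ?rhs")
proof -
  have ndvd: "\<not> int p dvd m" "\<not> int p dvd d" "\<not> int p dvd m - d" using m(2) by auto
  then have nz: "m \<noteq> 0" "d \<noteq> 0" "m - d \<noteq> 0" by auto
  define D M t z \<epsilon> where "D = (of_int d :: rat)" and "M = (of_int m :: rat)" and "t = D / M" and "z =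
    (1 - t) ^ 2 / t"
    and "\<epsilon> = ((-1) ^ half :: rat)"
  have nzr: "M \<noteq> 0" "D \<noteq> 0" "M - D \<noteq> 0" using nz by (simp_all add: D_def M_def)
  have t0: "t \<noteq> 0" "1 - t \<noteq> 0" using nzr by (auto simp: t_def)
  have t1: "1 - t = (M - D) / M" using nzr by (simp add: t_def field_simps)
  have pt: "pint t" "pint (1 / t)" unfolding t_def D_def M_def using ndvd pint_divide_int[of "of_int m" d] by
    (auto intro!: pint_divide_int)
  have pu: "pint (t / (1 - t))"
  proof -
    have "t / (1 - t) = of_int d / of_int (m - d)" unfolding t1 using nzr by (simp add: t_def D_def M_def)
    then show ?thesis using pint_divide_int[OF pint_of_int[of d] ndvd(3)] by (simp only:)
  qed
  have p\<epsilon>: "pint \<epsilon>" unfolding \<epsilon>_def by (intro pint_power) simp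
  have tq: "t ^ (p - 1) - 1 \<equiv>\<^bsub>2\<^esub> D ^ (p - 1) - M ^ (p - 1)"
    unfolding t_def D_def M_def by (rule quotient_power_cong[OF ndvd(2,1)])
  have tf: "t ^ (p - 1) \<equiv>\<^bsub>1\<^esub> 1"
  proof -
    have "D ^ (p - 1) - M ^ (p - 1) \<equiv>\<^bsub>1\<^esub> 1 - 1"
      using cong_diff[OF fermat_cong[OF ndvd(2)] fermat_cong[OF ndvd(1)]] by (simp add: D_def M_def)
    then have "t ^ (p - 1) - 1 + 1 \<equiv>\<^bsub>1\<^esub> 1 - 1 + 1"
      by (intro cong_add cong_trans[OF cong_weaken[OF tq]]) auto
    then show ?thesis by simp
  qed
  \<comment> \<open>The quadratic condition on m is what makes the weights in the sum over j the
    numbers covered by \<open>central_binomial_square_cong\<close>.\<close>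
  have y: "of_int c / of_int d = z / 16"
  proof -
    have "of_int ((m - d) ^ 2) = (of_int (16 * m * c) :: rat)" unfolding m(1) ..
    then have "(M - D) ^ 2 = 16 * M * of_int c" by (simp add: D_def M_def)
    then show ?thesis unfolding z_def t1 using nzr
      by (simp add: t_def D_def[symmetric] power_divide field_simps power2_eq_square)
  qed
  define K where "K = (\<Sum>k=1..half. (-1) ^ k * ((1 / t) ^ k - t ^ k) / of_nat k)"
  define S1 S2 where "S1 = central_S (p - 1) ((1 + t) / 4)" and "S2 = central_S (p - 1) ((1 + 1 / t) / 4)"
  have K: "K \<equiv>\<^bsub>1\<^esub> S2 - S1"
  proof -
    have "S2 - S1 \<equiv>\<^bsub>1\<^esub> (\<Sum>k=1..half. ((- (1 / t)) ^ k - 1) / of_nat k) -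
      (\<Sum>k=1..half. ((- t) ^ k - 1) / of_nat k)"
      unfolding S1_def S2_def by (intro cong_diff central_S_cong pt)
    also have "\<dots> = K"
    proof -
      have "((- s) ^ k - 1) / n - ((- t) ^ k - 1) / n = (-1) ^ k * (s ^ k - t ^ k) / n" for s n :: rat and k
        unfolding power_minus[of s k] power_minus[of t k] by (simp add: diff_divide_distrib right_diff_distrib)
      then show ?thesis unfolding K_def sum_subtractf[symmetric] by (simp only:)
    qed
    finally show ?thesis by (rule cong_sym)
  qed
  \<comment> \<open>The factor 1 + t comes from the boundary terms and completes 1/t - t, so only 1
    - t is divided out and t = -1 needs no separate case.\<close>
  have W: "(1 + t) * weighted_recip z half = t / (1 - t) * \<epsilon> * K"
  proof -
    have "(1 / t - t) * weighted_recip z half = \<epsilon> * K"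
      unfolding z_def K_def \<epsilon>_def by (rule weighted_recip_closed_form[OF t0(1)])
    moreover have "1 / t - t = (1 - t) * (1 + t) / t" using t0 by (simp add: field_simps)
    ultimately have "(1 - t) * ((1 + t) * weighted_recip z half) = t * (\<epsilon> * K)" using t0 by (simp add:
      field_simps)
    then show ?thesis using t0(2) by (simp add: nonzero_eq_divide_eq mult_ac)
  qed
  \<comment> \<open>The geometric sum, arranged to isolate t^(p-1) - 1, the source of the Fermat
    quotients.\<close>
  have gf0: "shifted_gf p 0 t = 1 - t / (1 - t) * (t ^ (p - 1) - 1)"
  proof -
    have "t ^ p = t * t ^ (p - 1)" using p_eq by (simp flip: power_Suc)
    moreover have "(1 - t) * shifted_gf p 0 t = 1 - t ^ p"
      unfolding shifted_gf_def using one_diff_power_eq[of t p] by simp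
    ultimately have "(1 - t) * shifted_gf p 0 t = (1 - t) - t * (t ^ (p - 1) - 1)" by (simp add: algebra_simps)
    then show ?thesis using t0(2) by (simp add: field_simps)
  qed
  have "(\<Sum>k=0..p-1. of_int (trinomial_T k b c) ^ 2 / of_int m ^ k)
     \<equiv>\<^bsub>2\<^esub> (\<Sum>j\<le>half. of_nat ((2 * j) choose j) ^ 2 * (z / 16) ^ j * shifted_gf p j t)"
    using sum_trinomial_T_square_cong[OF d ndvd(2), of "of_int m"] pt(1)
    unfolding y t_def D_def M_def by simp
  also have "\<dots> \<equiv>\<^bsub>2\<^esub> \<epsilon> * shifted_gf p 0 t + of_nat p * ((1 + t) *
    weighted_recip z half)"
    unfolding z_def \<epsilon>_def by (rule weighted_shifted_gf_cong[OF pt t0(1) tf])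
  also have "\<dots> = \<epsilon> * (1 - t / (1 - t) * (t ^ (p - 1) - 1)) + of_nat p * (t / (1 - t) * \<epsilon> * K)"
    unfolding W gf0 ..
  also have "\<dots> \<equiv>\<^bsub>2\<^esub> \<epsilon> * (1 - t / (1 - t) * (D ^ (p - 1) - M ^ (p - 1))) +
    of_nat p * (t / (1 - t) * \<epsilon> * (S2 - S1))"
    by (intro cong_add cong_mult_left cong_diff cong_p_mult tq K pu p\<epsilon> pint_mult) auto
  also have "\<dots> = ?rhs"
  proof -
    have "of_int (m + d) / (4 * of_int m) = (1 + t) / 4" "of_int (m + d) / (4 * of_int d) = (1 + 1 / t) / 4"
      using nzr by (simp_all add: t_def D_def M_def field_simps)
    then have S: "central_S (p - 1) (of_int (m + d) / (4 * of_int m)) = S1"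
      "central_S (p - 1) (of_int (m + d) / (4 * of_int d)) = S2"
      by (simp_all only: S1_def S2_def)
    have L: "of_int (Legendre (-1) (int p)) = \<epsilon>" unfolding Legendre_neg1 \<epsilon>_def by simp
    \<comment> \<open>The sign turns m - d into d - m and thereby reverses the difference of the two
      values of \<open>central_S\<close>.\<close>
    have x: "t / (1 - t) = - (D / (D - M))" unfolding t1 using nzr by (simp add: t_def field_simps)
    have x': "of_nat p * of_int d / of_int (d - m) = of_nat p * (D / (D - M))" by (simp add: D_def M_def)
    have q: "D ^ (p - 1) - M ^ (p - 1) = of_nat p * (fermat_quotient p d - fermat_quotient p m)"
      unfolding right_diff_distrib using prime_gt_0_nat[OF prime] by (simp add: fermat_quotient_def D_def M_def)
    have "\<epsilon> * (1 - (- x) * (of_nat p * Q)) + of_nat p * (- x * \<epsilon> * (S2 - S1)) = \<epsilon> +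
      of_nat p * x * \<epsilon> * (Q + S1 - S2)" for x Q
      by (simp add: algebra_simps)
    then show ?thesis unfolding S L x x' q .
  qed
  finally show ?thesis .
qed

end

theorem theorem1p1:
  fixes p :: nat and b c d :: int
  assumes "prime p" and "odd p"
    and "d = b ^ 2 - 4 * c"
  shows "(\<not> int p dvd d \<longrightarrow>
      padic_cong p 2
        (\<Sum>k=0..p-1. of_int (trinomial_T k b c) ^ 2 / (- of_int d) ^ k)
        (\<Sum>l=0..(p-1) div 2. of_nat ((2 * l) choose l) ^ 2 * (- (of_int c / (4 * of_int d))) ^ l))
    \<and> (\<forall>m :: int. (m - d) ^ 2 = 16 * m * c \<and> \<not> int p dvd m * d * (m - d) \<longrightarrow>
      padic_cong p 2
        (\<Sum>k=0..p-1. of_int (trinomial_T k b c) ^ 2 / of_int m ^ k)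
        (of_int (Legendre (-1) (int p))
          + of_nat p * of_int d / of_int (d - m) * of_int (Legendre (-1) (int p))
            * (fermat_quotient p d - fermat_quotient p m
               + central_S (p - 1) (of_int (m + d) / (4 * of_int m))
               - central_S (p - 1) (of_int (m + d) / (4 * of_int d)))))"
proof -
  interpret odd_prime p by unfold_locales (fact assms)+
  show ?thesis
    using sum_trinomial_T_square_neg_discriminant[OF assms(3), unfolded half_def]
      sum_trinomial_T_square_quadratic_parameter[OF assms(3)]
    by blast
qed

end
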